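(* Let $\eta\ge0$ and consider the planar system $$\dot x=y-x|y|-2\eta x,\qquad -\dot y=x-\tfrac12y|y|-2\eta y .$$ (i) If $0\le\eta<1/2$, the equilibrium points of the system are exactly $(0,0)$ and $\pm\overline P$, where $$\overline P=(\overline x,\overline y)=\Big(1-\eta^2-\eta\sqrt{2+\eta^2},\ \sqrt{2+\eta^2}-3\eta\Big).$$ Moreover, there is a two-parameter family of (nonconstant) periodic solutions, which can be indexed by the peak amplitude of $x$, ranging over $(0,\overline x)$, and the phase. The period of these solutions increases continuously over $\big(2\pi/\sqrt{1-4\eta^2},\,\infty\big)$ as the peak amplitude of $x$ increases over $(0,\overline x)$. (ii) If $\eta\ge1/2$, then $(0,0)$ is the unique equilibrium point and there are no (nonconstant) periodic solutions.
   Context: The system is the reduced form ($x=2\theta-1$, $y=u_1-u_0$, with $\theta$ the fraction of players in state 0 and $u_i$ the relative cost-to-go in state $i$) of the mean field game equations for the two-state follow the crowd game, with running cost $f(0,\theta)=1-\theta$, $f(1,\theta)=\theta$ plus control cost $\alpha^2/2$, and background jump rate $\eta$. Its equilibrium points and periodic solutions are the constant and periodic infinite horizon average cost mean field game solutions. The peak amplitude of $x$ for a periodic solution is $\max_t x_t$. *)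

theory Defs
  imports "HOL-Analysis.Analysis"
begin

definition mfg_field :: "real \<Rightarrow> real \<times> real \<Rightarrow> real \<times> real" where
  "mfg_field \<eta> p = (case p of (x, y) \<Rightarrow>
     (y - x * \<bar>y\<bar> - 2 * \<eta> * x, - (x - 1/2 * y * \<bar>y\<bar> - 2 * \<eta> * y)))"

definition equilibrium_point :: "real \<Rightarrow> real \<times> real \<Rightarrow> bool" where
  "equilibrium_point \<eta> p \<longleftrightarrow> mfg_field \<eta> p = 0"

definition mfg_solution :: "real \<Rightarrow> (real \<Rightarrow> real \<times> real) \<Rightarrow> bool" where
  "mfg_solution \<eta> z \<longleftrightarrow> (\<forall>t. (z has_vector_derivative mfg_field \<eta> (z t)) (at t))"

definition nonconstant_periodic_solution :: "real \<Rightarrow> (real \<Rightarrow> real \<times> real) \<Rightarrow> bool" where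
  "nonconstant_periodic_solution \<eta> z \<longleftrightarrow>
     mfg_solution \<eta> z \<and> (\<exists>s t. z s \<noteq> z t) \<and> (\<exists>T>0. \<forall>t. z (t + T) = z t)"

text \<open>The period of a solution is its minimal positive period.\<close>

definition has_period :: "(real \<Rightarrow> real \<times> real) \<Rightarrow> real \<Rightarrow> bool" where
  "has_period z T \<longleftrightarrow> T > 0 \<and> (\<forall>t. z (t + T) = z t) \<and>
     (\<forall>S. 0 < S \<and> S < T \<longrightarrow> (\<exists>t. z (t + S) \<noteq> z t))"

definition has_peak_amplitude :: "(real \<Rightarrow> real \<times> real) \<Rightarrow> real \<Rightarrow> bool" where
  "has_peak_amplitude z a \<longleftrightarrow> (\<exists>t. fst (z t) = a) \<and> (\<forall>t. fst (z t) \<le> a)"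

definition P_bar :: "real \<Rightarrow> real \<times> real" where
  "P_bar \<eta> = (1 - \<eta>\<^sup>2 - \<eta> * sqrt (2 + \<eta>\<^sup>2), sqrt (2 + \<eta>\<^sup>2) - 3 * \<eta>)"

abbreviation x_bar :: "real \<Rightarrow> real" where
  "x_bar \<eta> \<equiv> fst (P_bar \<eta>)"

text \<open>
  The family of periodic solutions is parametrised by the peak amplitude \<open>a\<close> and a phase
  \<open>s \<in> [0, T a)\<close>, the member with parameters \<open>(a, s)\<close> being the time shift \<open>t \<mapsto> Z a (t + s)\<close> of
  a reference solution \<open>Z a\<close> that attains its peak at time 0. That peak amplitude and phase index
  the family means that every nonconstant periodic solution arises from exactly one pair
  \<open>(a, s)\<close>.
\<close>

definition indexed_by_peak_and_phase ::
  "real \<Rightarrow> (real \<Rightarrow> real \<Rightarrow> real \<times> real) \<Rightarrow> (real \<Rightarrow> real) \<Rightarrow> bool" where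
  "indexed_by_peak_and_phase \<eta> Z T \<longleftrightarrow>
     (\<forall>a\<in>{0<..<x_bar \<eta>}. has_peak_amplitude (Z a) a \<and> fst (Z a 0) = a \<and> has_period (Z a) (T a)) \<and>
     bij_betw (\<lambda>(a, s). \<lambda>t. Z a (t + s))
       (SIGMA a:{0<..<x_bar \<eta>}. {0..<T a})
       {z. nonconstant_periodic_solution \<eta> z}"

end

theory Submission
  imports Defs "HOL-Analysis.Analysis"
begin

text \<open>
  The system is equivalent to the scalar equation \<open>y'' = - force y\<close> with \<open>x = drift y - y'\<close>. Its
  conserved quantity is \<open>y'\<^sup>2 + energy y\<close>. The ratio \<open>force y / y\<close> depends only on \<open>\<bar>y\<bar>\<close>, decreases
  with it and vanishes at \<open>\<bar>y\<bar> = y_bar\<close>: a softening spring, whose restoring force reverses beyond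
  \<open>y_bar\<close> and is nowhere attractive when \<open>\<eta> \<ge> 1/2\<close>. The signs of \<open>y''\<close> at the maximum and minimum
  of \<open>y\<close> therefore force every nonconstant periodic solution to oscillate with some amplitude
  \<open>A \<in> (0, y_bar)\<close>. Conversely \<open>y = A sin \<phi>\<close> turns the equation into the autonomous equation
  \<open>\<phi>' = sqrt (stiffness A (sin \<phi>))\<close>, so the period is the integral of \<open>1 / \<phi>'\<close> over a full turn.
  The integrand increases strictly with \<open>A\<close>, is constant at \<open>A = 0\<close>, and develops a nonintegrable
  singularity as \<open>A\<close> tends to \<open>y_bar\<close>. The peak \<open>a\<close> of \<open>x\<close> is an increasing function of \<open>A\<close>, because
  the minimum over \<open>y\<close> of the Hamiltonian at \<open>x = a\<close> increases with \<open>a\<close> up to the saddle.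
\<close>

section \<open>The equivalent scalar equation\<close>

definition drift :: "real \<Rightarrow> real \<Rightarrow> real" where
  "drift \<eta> y = y * \<bar>y\<bar> / 2 + 2 * \<eta> * y"

definition force :: "real \<Rightarrow> real \<Rightarrow> real" where
  "force \<eta> y = y * (1 - 4 * \<eta>\<^sup>2 - 3 * \<eta> * \<bar>y\<bar> - y\<^sup>2 / 2)"

definition energy :: "real \<Rightarrow> real \<Rightarrow> real" where
  "energy \<eta> y = y\<^sup>2 - (drift \<eta> y)\<^sup>2"

lemma mfg_field_drift: "mfg_field \<eta> (x, y) = (y - x * (\<bar>y\<bar> + 2 * \<eta>), drift \<eta> y - x)"
  by (simp add: mfg_field_def drift_def algebra_simps)

lemma force_drift: "force \<eta> y = y - drift \<eta> y * (\<bar>y\<bar> + 2 * \<eta>)"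
proof -
  have "\<bar>y\<bar> * \<bar>y\<bar> = y * y" by simp
  then show ?thesis unfolding force_def drift_def by algebra
qed

lemma energy_factor: "energy \<eta> y = y\<^sup>2 * (1 - (\<bar>y\<bar> / 2 + 2 * \<eta>)\<^sup>2)"
  unfolding energy_def drift_def by (simp add: power2_eq_square algebra_simps)

text \<open>Away from 0 this is a polynomial on an open half line, and at 0 the difference quotient
  is \<open>\<bar>h\<bar>\<close>. Hence \<open>drift\<close> and \<open>energy\<close> are
  differentiable everywhere in spite of the absolute values.\<close>

lemma has_real_derivative_mult_abs:
  "((\<lambda>y::real. y * \<bar>y\<bar>) has_real_derivative 2 * \<bar>y\<bar>) (at y)"
proof -
  consider "y > 0" | "y < 0" | "y = 0" by linarith
  then show ?thesis
  proof cases
    case 1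
    have "((\<lambda>y::real. y * y) has_real_derivative 2 * \<bar>y\<bar>) (at y)"
      using 1 by (auto intro!: derivative_eq_intros)
    then show ?thesis
      by (rule has_field_derivative_transform_within_open[where S = "{0<..}"]) (use 1 in auto)
  next
    case 2
    have "((\<lambda>y::real. y * - y) has_real_derivative 2 * \<bar>y\<bar>) (at y)"
      using 2 by (auto intro!: derivative_eq_intros)
    then show ?thesis
      by (rule has_field_derivative_transform_within_open[where S = "{..<0}"]) (use 2 in auto)
  next
    case 3
    have "((\<lambda>h::real. \<bar>h\<bar>) \<longlongrightarrow> 0) (at 0)"
      by (rule tendsto_rabs_zero) simp
    then have "((\<lambda>h::real. (h * \<bar>h\<bar>) / h) \<longlongrightarrow> 0) (at 0)"
      by (rule Lim_transform_eventually) (auto simp: eventually_at_filter)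
    with 3 show ?thesis by (simp add: DERIV_def)
  qed
qed

lemma has_real_derivative_drift:
  "(drift \<eta> has_real_derivative \<bar>y\<bar> + 2 * \<eta>) (at y)"
proof -
  have "((\<lambda>y. y * \<bar>y\<bar> / 2 + 2 * \<eta> * y) has_real_derivative (2 * \<bar>y\<bar>) / 2 + 2 * \<eta>) (at y)"
    by (intro DERIV_add DERIV_cdivide has_real_derivative_mult_abs)
      (auto intro!: derivative_eq_intros)
  then show ?thesis by (simp add: drift_def[abs_def])
qed

lemma has_real_derivative_energy:
  "(energy \<eta> has_real_derivative 2 * force \<eta> y) (at y)"
proof -
  have "((\<lambda>y. y\<^sup>2 - (drift \<eta> y)\<^sup>2) has_real_derivative 2 * y - 2 * drift \<eta> y * (\<bar>y\<bar> + 2 * \<eta>)) (at y)"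
    by (auto intro!: derivative_eq_intros has_real_derivative_drift)
  then show ?thesis by (simp add: energy_def[abs_def] force_drift algebra_simps)
qed

lemma mfg_solutionD:
  assumes "mfg_solution \<eta> z"
  shows "((\<lambda>t. fst (z t)) has_real_derivative
            snd (z t) - fst (z t) * (\<bar>snd (z t)\<bar> + 2 * \<eta>)) (at t)"
    and "((\<lambda>t. snd (z t)) has_real_derivative drift \<eta> (snd (z t)) - fst (z t)) (at t)"
proof -
  have "(z has_vector_derivative mfg_field \<eta> (fst (z t), snd (z t))) (at t)"
    using assms by (simp add: mfg_solution_def)
  then have d: "(z has_derivative (\<lambda>h. h *\<^sub>R (snd (z t) - fst (z t) * (\<bar>snd (z t)\<bar> + 2 * \<eta>),
      drift \<eta> (snd (z t)) - fst (z t)))) (at t)"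
    by (simp only: mfg_field_drift has_vector_derivative_def)
  show "((\<lambda>t. fst (z t)) has_real_derivative
            snd (z t) - fst (z t) * (\<bar>snd (z t)\<bar> + 2 * \<eta>)) (at t)"
    using has_derivative_fst[OF d] by (simp add: has_field_derivative_def mult_commute_abs)
  show "((\<lambda>t. snd (z t)) has_real_derivative drift \<eta> (snd (z t)) - fst (z t)) (at t)"
    using has_derivative_snd[OF d] by (simp add: has_field_derivative_def mult_commute_abs)
qed

lemma mfg_solutionI:
  assumes "\<And>t. (x has_real_derivative y t - x t * (\<bar>y t\<bar> + 2 * \<eta>)) (at t)"
    and "\<And>t. (y has_real_derivative drift \<eta> (y t) - x t) (at t)"
  shows "mfg_solution \<eta> (\<lambda>t. (x t, y t))"
  using assms unfolding mfg_solution_def mfg_field_drift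
  by (auto intro!: has_vector_derivative_Pair simp: has_real_derivative_iff_has_vector_derivative)

lemma mfg_solution_shift:
  assumes "mfg_solution \<eta> z"
  shows "mfg_solution \<eta> (\<lambda>t. z (t + s))"
proof -
  have "mfg_solution \<eta> (\<lambda>t. (fst (z (t + s)), snd (z (t + s))))"
    using mfg_solutionD[OF assms, THEN DERIV_shift[THEN iffD1]] by (intro mfg_solutionI) auto
  then show ?thesis by simp
qed

text \<open>The terms with \<open>x\<close> cancel because \<open>\<bar>y\<bar> + 2 * \<eta>\<close>
  is both the derivative of \<open>drift\<close> and the damping coefficient in the equation for
  \<open>x\<close>. This is the passage to the scalar second-order equation.\<close>

lemma mfg_solution_velocity:
  assumes "mfg_solution \<eta> z"
  shows "((\<lambda>t. drift \<eta> (snd (z t)) - fst (z t)) has_real_derivative - force \<eta> (snd (z t))) (at t)"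
  by (rule derivative_eq_intros DERIV_chain2[OF has_real_derivative_drift]
        mfg_solutionD[OF assms] refl)+
    (simp add: force_drift algebra_simps)

section \<open>Uniqueness of bounded solutions\<close>

lemma gronwall_zero:
  fixes D :: "real \<Rightarrow> real"
  assumes D: "\<And>t. (D has_real_derivative D' t) (at t)"
    and bound: "\<And>t. \<bar>D' t\<bar> \<le> L * D t" and nonneg: "\<And>t. 0 \<le> D t" and zero: "D t0 = 0"
  shows "D t = 0"
proof (cases "t0 \<le> t")
  case True
  have "D t * exp (- L * t) \<le> D t0 * exp (- L * t0)"
  proof (rule DERIV_nonpos_imp_nonincreasing[OF True])
    fix s
    have "((\<lambda>t. D t * exp (- L * t)) has_real_derivative (D' s - L * D s) * exp (- L * s)) (at s)"
      by (rule derivative_eq_intros D refl)+ (simp add: algebra_simps)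
    moreover have "(D' s - L * D s) * exp (- L * s) \<le> 0"
      using bound[of s] by (intro mult_nonpos_nonneg) auto
    ultimately show "\<exists>y. ((\<lambda>t. D t * exp (- L * t)) has_real_derivative y) (at s) \<and> y \<le> 0" by blast
  qed
  with zero have "D t * exp (- L * t) \<le> 0" by simp
  then show ?thesis using nonneg[of t] by (simp add: mult_le_0_iff)
next
  case False
  then have "t \<le> t0" by simp
  \<comment> \<open>Backwards in time the lower bound on \<open>D'\<close> is the relevant one,
    hence the opposite sign in the exponent.\<close>
  then have "D t * exp (L * t) \<le> D t0 * exp (L * t0)"
  proof (rule DERIV_nonneg_imp_nondecreasing)
    fix s
    have "((\<lambda>t. D t * exp (L * t)) has_real_derivative (D' s + L * D s) * exp (L * s)) (at s)"
      by (rule derivative_eq_intros D refl)+ (simp add: algebra_simps)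
    moreover have "(D' s + L * D s) * exp (L * s) \<ge> 0"
      using bound[of s] by (intro mult_nonneg_nonneg) auto
    ultimately show "\<exists>y. ((\<lambda>t. D t * exp (L * t)) has_real_derivative y) (at s) \<and> 0 \<le> y" by blast
  qed
  with zero have "D t * exp (L * t) \<le> 0" by simp
  then show ?thesis using nonneg[of t] by (simp add: mult_le_0_iff)
qed

text \<open>The expression in the outer absolute value is the time derivative of the squared
  distance of two solutions. The field has quadratic terms, so it is Lipschitz only on bounded sets
  and \<open>B\<close> enters the constant.\<close>

lemma mfg_field_one_sided_Lipschitz:
  fixes x1 y1 x2 y2 :: real
  assumes "\<eta> \<ge> 0" "\<bar>x1\<bar> \<le> B" "\<bar>y1\<bar> \<le> B" "\<bar>x2\<bar> \<le> B" "\<bar>y2\<bar> \<le> B"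
  defines "dx \<equiv> x1 - x2" and "dy \<equiv> y1 - y2"
  shows "\<bar>2 * dx * ((y1 - x1 * (\<bar>y1\<bar> + 2 * \<eta>)) - (y2 - x2 * (\<bar>y2\<bar> + 2 * \<eta>)))
      + 2 * dy * ((drift \<eta> y1 - x1) - (drift \<eta> y2 - x2))\<bar> \<le> 4 * (1 + B + 2 * \<eta>) * (dx\<^sup>2 + dy\<^sup>2)"
proof -
  have B: "B \<ge> 0" using assms(2) by linarith
  have 1: "\<bar>x1 * \<bar>y1\<bar> - x2 * \<bar>y2\<bar>\<bar> \<le> B * \<bar>dx\<bar> + B * \<bar>dy\<bar>"
  proof -
    have "x1 * \<bar>y1\<bar> - x2 * \<bar>y2\<bar> = \<bar>y1\<bar> * dx + x2 * (\<bar>y1\<bar> - \<bar>y2\<bar>)"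
      by (simp add: dx_def algebra_simps)
    also have "\<bar>\<dots>\<bar> \<le> \<bar>y1\<bar> * \<bar>dx\<bar> + \<bar>x2\<bar> * \<bar>\<bar>y1\<bar> - \<bar>y2\<bar>\<bar>"
      by (rule order.trans[OF abs_triangle_ineq]) (simp add: abs_mult)
    also have "\<dots> \<le> B * \<bar>dx\<bar> + B * \<bar>dy\<bar>"
      using assms(2-5) B by (intro add_mono mult_mono) (auto simp: dy_def)
    finally show ?thesis .
  qed
  have 2: "\<bar>y1 * \<bar>y1\<bar> - y2 * \<bar>y2\<bar>\<bar> \<le> 2 * B * \<bar>dy\<bar>"
  proof -
    have "y1 * \<bar>y1\<bar> - y2 * \<bar>y2\<bar> = \<bar>y1\<bar> * dy + y2 * (\<bar>y1\<bar> - \<bar>y2\<bar>)"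
      by (simp add: dy_def algebra_simps)
    also have "\<bar>\<dots>\<bar> \<le> \<bar>y1\<bar> * \<bar>dy\<bar> + \<bar>y2\<bar> * \<bar>\<bar>y1\<bar> - \<bar>y2\<bar>\<bar>"
      by (rule order.trans[OF abs_triangle_ineq]) (simp add: abs_mult)
    also have "\<dots> \<le> B * \<bar>dy\<bar> + B * \<bar>dy\<bar>"
      using assms(2-5) B by (intro add_mono mult_mono) (auto simp: dy_def)
    finally show ?thesis by simp
  qed
  define X where "X = (y1 - x1 * (\<bar>y1\<bar> + 2 * \<eta>)) - (y2 - x2 * (\<bar>y2\<bar> + 2 * \<eta>))"
  define Y where "Y = (drift \<eta> y1 - x1) - (drift \<eta> y2 - x2)"
  have "X = dy - (x1 * \<bar>y1\<bar> - x2 * \<bar>y2\<bar>) - 2 * \<eta> * dx"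
    by (simp add: X_def dx_def dy_def algebra_simps)
  moreover have "\<bar>2 * \<eta> * dx\<bar> = 2 * \<eta> * \<bar>dx\<bar>" using assms(1) by (simp add: abs_mult)
  ultimately have "\<bar>X\<bar> \<le> \<bar>dy\<bar> + (B * \<bar>dx\<bar> + B * \<bar>dy\<bar>) + 2 * \<eta> * \<bar>dx\<bar>"
    using 1 by linarith
  then have X: "\<bar>X\<bar> \<le> (1 + B) * \<bar>dy\<bar> + (B + 2 * \<eta>) * \<bar>dx\<bar>"
    by (simp add: algebra_simps)
  define Q where "Q = y1 * \<bar>y1\<bar> - y2 * \<bar>y2\<bar>"
  have "\<bar>Q\<bar> \<le> 2 * (B * \<bar>dy\<bar>)" using 2 by (simp add: Q_def)
  moreover have "Y = Q / 2 + 2 * \<eta> * dy - dx"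
    by (simp add: Y_def Q_def drift_def dx_def dy_def field_simps)
  moreover have "\<bar>2 * \<eta> * dy\<bar> = 2 * \<eta> * \<bar>dy\<bar>" using assms(1) by (simp add: abs_mult)
  ultimately have "\<bar>Y\<bar> \<le> B * \<bar>dy\<bar> + 2 * \<eta> * \<bar>dy\<bar> + \<bar>dx\<bar>"
    by linarith
  then have Y: "\<bar>Y\<bar> \<le> (B + 2 * \<eta>) * \<bar>dy\<bar> + \<bar>dx\<bar>"
    by (simp add: algebra_simps)
  have "\<bar>2 * dx * X + 2 * dy * Y\<bar> \<le> 2 * \<bar>dx\<bar> * \<bar>X\<bar> + 2 * \<bar>dy\<bar> * \<bar>Y\<bar>"
    by (rule order.trans[OF abs_triangle_ineq]) (simp add: abs_mult)
  also have "\<dots> \<le> 2 * \<bar>dx\<bar> * ((1 + B) * \<bar>dy\<bar> + (B + 2 * \<eta>) * \<bar>dx\<bar>)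
      + 2 * \<bar>dy\<bar> * ((B + 2 * \<eta>) * \<bar>dy\<bar> + \<bar>dx\<bar>)"
    using X Y by (intro add_mono mult_left_mono) auto
  also have "\<dots> = (2 + B) * (2 * \<bar>dx\<bar> * \<bar>dy\<bar>) + 2 * (B + 2 * \<eta>) * (dx\<^sup>2 + dy\<^sup>2)"
    by (simp add: algebra_simps power2_eq_square abs_mult_self_eq)
  also have "\<dots> \<le> (2 + B) * (dx\<^sup>2 + dy\<^sup>2) + 2 * (B + 2 * \<eta>) * (dx\<^sup>2 + dy\<^sup>2)"
    using B sum_squares_bound[of "\<bar>dx\<bar>" "\<bar>dy\<bar>"] by (intro add_right_mono mult_left_mono) auto
  also have "\<dots> = (2 + 3 * B + 4 * \<eta>) * (dx\<^sup>2 + dy\<^sup>2)" by (simp add: algebra_simps)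
  also have "\<dots> \<le> 4 * (1 + B + 2 * \<eta>) * (dx\<^sup>2 + dy\<^sup>2)"
    using B assms(1) by (intro mult_right_mono) auto
  finally show ?thesis by (simp add: X_def Y_def)
qed

text \<open>Boundedness supplies one Lipschitz constant for all times, so Gronwall applies to the
  squared distance on the whole line. Periodic solutions are bounded, which makes this enough for
  the classification.\<close>

lemma bounded_mfg_solution_unique:
  assumes "\<eta> \<ge> 0" and z1: "mfg_solution \<eta> z1" and z2: "mfg_solution \<eta> z2"
    and "bounded (range z1)" "bounded (range z2)" and eq: "z1 t0 = z2 t0"
  shows "z1 t = z2 t"
proof -
  obtain B1 B2 where "\<And>t. norm (z1 t) \<le> B1" "\<And>t. norm (z2 t) \<le> B2"
    using assms(4,5) unfolding bounded_iff by auto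
  then have *: "norm (z1 t) \<le> max B1 B2" "norm (z2 t) \<le> max B1 B2" for t
    by (simp_all add: le_max_iff_disj)
  have B: "\<bar>fst (z1 t)\<bar> \<le> max B1 B2" "\<bar>snd (z1 t)\<bar> \<le> max B1 B2"
    "\<bar>fst (z2 t)\<bar> \<le> max B1 B2" "\<bar>snd (z2 t)\<bar> \<le> max B1 B2" for t
    using *[of t] norm_fst_le[of "fst (z1 t)" "snd (z1 t)"] norm_snd_le[of "snd (z1 t)" "fst (z1 t)"]
      norm_fst_le[of "fst (z2 t)" "snd (z2 t)"] norm_snd_le[of "snd (z2 t)" "fst (z2 t)"]
    by simp_all
  define D where "D t = (fst (z1 t) - fst (z2 t))\<^sup>2 + (snd (z1 t) - snd (z2 t))\<^sup>2" for t
  have "D t = 0"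
  proof (rule gronwall_zero[where D = D])
    fix t
    show "(D has_real_derivative
        2 * (fst (z1 t) - fst (z2 t)) * ((snd (z1 t) - fst (z1 t) * (\<bar>snd (z1 t)\<bar> + 2 * \<eta>))
            - (snd (z2 t) - fst (z2 t) * (\<bar>snd (z2 t)\<bar> + 2 * \<eta>)))
        + 2 * (snd (z1 t) - snd (z2 t)) * ((drift \<eta> (snd (z1 t)) - fst (z1 t))
            - (drift \<eta> (snd (z2 t)) - fst (z2 t)))) (at t)"
      unfolding D_def
      by (rule derivative_eq_intros mfg_solutionD[OF z1] mfg_solutionD[OF z2] refl)+ (simp add: algebra_simps)
    show "\<bar>2 * (fst (z1 t) - fst (z2 t)) * ((snd (z1 t) - fst (z1 t) * (\<bar>snd (z1 t)\<bar> + 2 * \<eta>))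
            - (snd (z2 t) - fst (z2 t) * (\<bar>snd (z2 t)\<bar> + 2 * \<eta>)))
        + 2 * (snd (z1 t) - snd (z2 t)) * ((drift \<eta> (snd (z1 t)) - fst (z1 t))
            - (drift \<eta> (snd (z2 t)) - fst (z2 t)))\<bar> \<le> 4 * (1 + max B1 B2 + 2 * \<eta>) * D t"
      unfolding D_def by (rule mfg_field_one_sided_Lipschitz[OF assms(1) B])
    show "0 \<le> D t" by (simp add: D_def)
    show "D t0 = 0" by (simp add: D_def eq)
  qed
  then show ?thesis by (simp add: D_def sum_power2_eq_zero_iff prod_eq_iff)
qed

section \<open>Extremum tests and periodic functions\<close>

lemma second_derivative_at_max:
  fixes f :: "real \<Rightarrow> real"
  assumes f: "\<And>t. (f has_real_derivative f' t) (at t)"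
    and f': "(f' has_real_derivative l) (at t0)" and max: "\<And>t. f t \<le> f t0"
  shows "f' t0 = 0" "l \<le> 0"
proof -
  show 0: "f' t0 = 0"
    by (rule DERIV_local_max[OF f[of t0], of 1]) (auto simp: max)
  show "l \<le> 0"
  proof (rule ccontr)
    assume "\<not> l \<le> 0"
    then obtain d where d: "d > 0" "\<And>h. 0 < h \<Longrightarrow> h < d \<Longrightarrow> f' t0 < f' (t0 + h)"
      using DERIV_pos_inc_right[OF f'] by auto
    have "f t0 < f (t0 + d / 2)"
    proof (rule DERIV_pos_imp_increasing_open[where f = f])
      fix s assume "t0 < s" "s < t0 + d / 2"
      then have "0 < f' s" using d(2)[of "s - t0"] 0 d(1) by simp
      then show "\<exists>y. (f has_real_derivative y) (at s) \<and> y > 0" using f by blast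
    qed (use d f in \<open>auto intro!: DERIV_isCont continuous_at_imp_continuous_on\<close>)
    with max[of "t0 + d / 2"] show False by simp
  qed
qed

lemma second_derivative_at_min:
  fixes f :: "real \<Rightarrow> real"
  assumes f: "\<And>t. (f has_real_derivative f' t) (at t)"
    and f': "(f' has_real_derivative l) (at t0)" and min: "\<And>t. f t0 \<le> f t"
  shows "f' t0 = 0" "0 \<le> l"
  using second_derivative_at_max[of "\<lambda>t. - f t" "\<lambda>t. - f' t" "- l" t0] DERIV_minus[OF f]
    DERIV_minus[OF f'] min by auto

lemma periodic_add_of_int:
  fixes f :: "real \<Rightarrow> 'a"
  assumes "\<And>t. f (t + T) = f t"
  shows "f (t + of_int k * T) = f t"
proof (induction k rule: int_induct[where k = 0])
  case (step1 i)
  then show ?case using assms[of "t + of_int i * T"] by (simp add: algebra_simps)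
next
  case (step2 i)
  then show ?case using assms[of "t + of_int (i - 1) * T"] by (simp add: algebra_simps)
qed simp

text \<open>Reduces an arbitrary time shift to a phase in the half-open interval used for indexing,
  by subtracting the right integer multiple of \<open>T\<close>.\<close>

lemma periodic_representative:
  fixes f :: "real \<Rightarrow> 'a"
  assumes "T > 0" "\<And>t. f (t + T) = f t"
  obtains s where "s \<in> {0..<T}" "\<And>t. f (t + r) = f (t + s)"
proof -
  define s where "s = r + of_int (- \<lfloor>r / T\<rfloor>) * T"
  have "s \<in> {0..<T}"
    using floor_divide_lower[OF assms(1), of r] floor_divide_upper[OF assms(1), of r]
    by (simp add: s_def algebra_simps)
  moreover have "f (t + s) = f (t + r)" for t
    unfolding s_def using periodic_add_of_int[of f T "t + r" "- \<lfloor>r / T\<rfloor>", OF assms(2)]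
    by (simp only: add.assoc)
  ultimately show ?thesis using that by auto
qed

lemma periodic_compact_range:
  fixes f :: "real \<Rightarrow> 'a::topological_space"
  assumes "continuous_on UNIV f" "T > 0" "\<And>t. f (t + T) = f t"
  shows "compact (range f)"
proof -
  have "range f = f ` {0..T}"
  proof
    show "range f \<subseteq> f ` {0..T}"
    proof clarify
      fix r
      obtain s where s: "s \<in> {0..<T}" "\<And>t. f (t + r) = f (t + s)"
        using periodic_representative[where f = f and r = r, OF assms(2,3)] by blast
      then show "f r \<in> f ` {0..T}" using s(2)[of 0] by auto
    qed
  qed auto
  moreover have "continuous_on {0..T} f" using assms(1) continuous_on_subset by blast
  ultimately show ?thesis using compact_continuous_image by fastforce
qed

lemma mfg_solution_continuous:
  assumes "mfg_solution \<eta> z" shows "continuous_on UNIV z"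
  using assms unfolding mfg_solution_def
  by (meson continuous_at_imp_continuous_on has_vector_derivative_continuous)

lemma mfg_solution_equilibrium:
  assumes "equilibrium_point \<eta> p" shows "mfg_solution \<eta> (\<lambda>t. p)"
  using assms by (simp add: mfg_solution_def equilibrium_point_def)

section \<open>Equilibria and turning points\<close>

abbreviation y_bar :: "real \<Rightarrow> real" where
  "y_bar \<eta> \<equiv> snd (P_bar \<eta>)"

text \<open>As a quadratic in \<open>\<bar>y\<bar>\<close>, the bracket in \<open>force\<close> has
  the roots \<open>y_bar\<close> and \<open>- (y_bar + 6 * \<eta>)\<close>, that is
  \<open>- 3 * \<eta>\<close> plus or minus \<open>sqrt (2 + \<eta>\<^sup>2)\<close>.\<close>

lemma force_factor:
  "force \<eta> y = y * (y_bar \<eta> - \<bar>y\<bar>) * (\<bar>y\<bar> + y_bar \<eta> + 6 * \<eta>) / 2"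
proof -
  define r where "r = sqrt (2 + \<eta>\<^sup>2)"
  have "r * r = 2 + \<eta> * \<eta>" by (simp add: r_def power2_eq_square)
  moreover have "\<bar>y\<bar> * \<bar>y\<bar> = y * y" by simp
  moreover have "y_bar \<eta> = r - 3 * \<eta>" by (simp add: P_bar_def r_def)
  ultimately show ?thesis unfolding force_def by algebra
qed

lemma y_bar_plus_pos: assumes "\<eta> \<ge> 0" shows "y_bar \<eta> + 6 * \<eta> > 0"
proof -
  have "2 + \<eta>\<^sup>2 > 0" by (simp add: add_pos_nonneg)
  then have "sqrt (2 + \<eta>\<^sup>2) > 0" by (rule real_sqrt_gt_zero)
  then have "0 < sqrt (2 + \<eta>\<^sup>2) + 3 * \<eta>" using assms by linarith
  then show ?thesis by (simp add: P_bar_def algebra_simps)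
qed

text \<open>The product of \<open>y_bar\<close> and the positive number
  \<open>y_bar + 6 * \<eta>\<close> is \<open>2 * (1 - 4 * \<eta>\<^sup>2)\<close>. This is where
  the threshold 1/2 comes from.\<close>

lemma y_bar_pos_iff: assumes "\<eta> \<ge> 0" shows "y_bar \<eta> > 0 \<longleftrightarrow> \<eta> < 1 / 2"
proof -
  define r where "r = sqrt (2 + \<eta>\<^sup>2)"
  have "r * r = 2 + \<eta> * \<eta>" by (simp add: r_def power2_eq_square)
  moreover have "y_bar \<eta> = r - 3 * \<eta>" by (simp add: P_bar_def r_def)
  ultimately have "y_bar \<eta> * (y_bar \<eta> + 6 * \<eta>) = 2 * (1 - 2 * \<eta>) * (1 + 2 * \<eta>)" by algebra
  then have "y_bar \<eta> * (y_bar \<eta> + 6 * \<eta>) > 0 \<longleftrightarrow> 2 * (1 - 2 * \<eta>) * (1 + 2 * \<eta>) > 0" by simp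
  moreover have "1 + 2 * \<eta> > 0" using assms by simp
  ultimately have "y_bar \<eta> > 0 \<longleftrightarrow> 1 - 2 * \<eta> > 0"
    using y_bar_plus_pos[OF assms] by (simp only: zero_less_mult_iff) auto
  then show ?thesis by auto
qed

lemma force_eq_0_iff:
  assumes "\<eta> \<ge> 0" shows "force \<eta> y = 0 \<longleftrightarrow> y = 0 \<or> \<bar>y\<bar> = y_bar \<eta>"
  using y_bar_plus_pos[OF assms] abs_ge_zero[of y] unfolding force_factor by auto

lemma equilibrium_point_iff: "equilibrium_point \<eta> (x, y) \<longleftrightarrow> x = drift \<eta> y \<and> force \<eta> y = 0"
  by (auto simp: equilibrium_point_def mfg_field_drift force_drift zero_prod_def)

lemma drift_y_bar:
  assumes "\<eta> \<ge> 0" "\<eta> < 1 / 2" shows "drift \<eta> (y_bar \<eta>) = x_bar \<eta>"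
proof -
  define r where "r = sqrt (2 + \<eta>\<^sup>2)"
  have r: "r * r = 2 + \<eta> * \<eta>" by (simp add: r_def power2_eq_square)
  have "\<bar>y_bar \<eta>\<bar> = y_bar \<eta>" using y_bar_pos_iff[OF assms(1)] assms(2) by simp
  moreover have "y_bar \<eta> = r - 3 * \<eta>" "x_bar \<eta> = 1 - \<eta> * \<eta> - \<eta> * r"
    by (simp_all add: P_bar_def r_def power2_eq_square)
  ultimately show ?thesis using r unfolding drift_def by simp algebra
qed

lemma drift_minus: "drift \<eta> (- y) = - drift \<eta> y"
  by (simp add: drift_def)

lemma equilibria_subcritical:
  assumes "\<eta> \<ge> 0" "\<eta> < 1 / 2"
  shows "{p. equilibrium_point \<eta> p} = {(0, 0), P_bar \<eta>, - P_bar \<eta>}"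
proof -
  have "equilibrium_point \<eta> (x, y) \<longleftrightarrow> (x, y) \<in> {(0, 0), P_bar \<eta>, - P_bar \<eta>}" for x y
  proof -
    have "\<bar>y\<bar> = y_bar \<eta> \<longleftrightarrow> y = y_bar \<eta> \<or> y = - y_bar \<eta>"
      using y_bar_pos_iff[OF assms(1)] assms(2) by auto
    then show ?thesis
      unfolding equilibrium_point_iff force_eq_0_iff[OF assms(1)] drift_y_bar[OF assms, symmetric]
      using drift_y_bar[OF assms]
      by (auto simp: prod_eq_iff drift_minus drift_def[of _ 0])
  qed
  then show ?thesis by auto
qed

lemma equilibria_supercritical:
  assumes "\<eta> \<ge> 1 / 2" shows "{p. equilibrium_point \<eta> p} = {(0, 0)}"
proof -
  have "\<eta> \<ge> 0" "\<not> y_bar \<eta> > 0" using y_bar_pos_iff[of \<eta>] assms by auto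
  then have "\<bar>y\<bar> = y_bar \<eta> \<longrightarrow> y = 0" for y
    by (metis zero_less_abs_iff)
  then have "force \<eta> y = 0 \<longleftrightarrow> y = 0" for y
    using force_eq_0_iff[OF \<open>\<eta> \<ge> 0\<close>, of y] by blast
  moreover have "drift \<eta> 0 = 0" by (simp add: drift_def)
  ultimately have "equilibrium_point \<eta> (x, y) \<longleftrightarrow> (x, y) = (0, 0)" for x y
    unfolding equilibrium_point_iff prod.inject by metis
  then show ?thesis by (simp only: set_eq_iff mem_Collect_eq singleton_iff split_paired_all) simp
qed

text \<open>The point is a global maximum of \<open>y\<close>. There \<open>y' = 0\<close> and
  \<open>force\<close> is nonnegative, and it cannot vanish, since uniqueness would then make the
  solution an equilibrium. For \<open>\<eta> >= 1/2\<close> the interval below \<open>y_bar\<close>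
  is empty, so the lemma also rules out periodic solutions.\<close>

lemma periodic_solution_turning_point:
  assumes "\<eta> \<ge> 0" and z: "nonconstant_periodic_solution \<eta> z"
  obtains t where "0 < snd (z t)" "snd (z t) < y_bar \<eta>" "fst (z t) = drift \<eta> (snd (z t))"
proof -
  have sol: "mfg_solution \<eta> z" using z by (simp add: nonconstant_periodic_solution_def)
  obtain T where T: "T > 0" "\<And>t. z (t + T) = z t"
    using z by (auto simp: nonconstant_periodic_solution_def)
  have "compact (range (\<lambda>t. snd (z t)))"
    using mfg_solution_continuous[OF sol] T by (intro periodic_compact_range continuous_intros) auto
  then obtain t0 t1 where max: "\<And>t. snd (z t) \<le> snd (z t0)" and min: "\<And>t. snd (z t1) \<le> snd (z t)"
    using compact_attains_sup[of "range (\<lambda>t. snd (z t))"]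
      compact_attains_inf[of "range (\<lambda>t. snd (z t))"] by auto
  define A where "A = snd (z t0)"
  define B where "B = snd (z t1)"
  note max_test = second_derivative_at_max[OF mfg_solutionD(2)[OF sol] mfg_solution_velocity[OF sol] max]
  have A: "fst (z t0) = drift \<eta> A" "force \<eta> A \<ge> 0" using max_test by (simp_all add: A_def)
  have B: "force \<eta> B \<le> 0"
    using second_derivative_at_min[OF mfg_solutionD(2)[OF sol] mfg_solution_velocity[OF sol] min]
    by (simp add: B_def)
  have "force \<eta> A \<noteq> 0"
  proof
    assume "force \<eta> A = 0"
    then have "equilibrium_point \<eta> (z t0)"
      using A by (metis A_def equilibrium_point_iff prod.collapse)
    then have "z t = z t0" for t
      using bounded_mfg_solution_unique[OF assms(1) sol mfg_solution_equilibrium, of "z t0" t0 t]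
        periodic_compact_range[OF mfg_solution_continuous[OF sol] T] compact_imp_bounded by auto
    then show False using z by (metis nonconstant_periodic_solution_def)
  qed
  with A(2) have pos: "force \<eta> A > 0" by simp
  \<comment> \<open>A negative maximum with positive force lies below \<open>- y_bar\<close>. The
    minimum \<open>B\<close> lies lower still, where the force is again positive, so
    \<open>y''\<close> would be negative at a minimum.\<close>
  have "A > 0"
  proof (rule ccontr)
    assume "\<not> A > 0"
    moreover have "A \<noteq> 0" using pos by (auto simp: force_def)
    ultimately have "A < 0" by simp
    have p: "\<bar>y\<bar> + y_bar \<eta> + 6 * \<eta> > 0" for y
      using y_bar_plus_pos[OF assms(1)] by (simp add: add.assoc add_nonneg_pos)
    have "A * (y_bar \<eta> - \<bar>A\<bar>) > 0"
      using pos p[of A] by (simp add: force_factor zero_less_mult_iff)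
    with \<open>A < 0\<close> have "y_bar \<eta> < \<bar>A\<bar>" by (simp add: zero_less_mult_iff)
    moreover have "B \<le> A" using max by (simp add: A_def B_def)
    ultimately have "B < 0" "y_bar \<eta> < \<bar>B\<bar>" using \<open>A < 0\<close> by auto
    then have "B * (y_bar \<eta> - \<bar>B\<bar>) > 0" by (intro mult_neg_neg) auto
    then have "force \<eta> B > 0" using p[of B] by (simp add: force_factor)
    with B show False by simp
  qed
  moreover have "A < y_bar \<eta>"
  proof -
    have "A * ((y_bar \<eta> - A) * (A + y_bar \<eta> + 6 * \<eta>)) > 0"
      using pos \<open>A > 0\<close> by (simp add: force_factor mult.assoc)
    then have "(y_bar \<eta> - A) * (A + y_bar \<eta> + 6 * \<eta>) > 0"
      using \<open>A > 0\<close> by (simp only: zero_less_mult_iff) auto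
    moreover have "A + y_bar \<eta> + 6 * \<eta> > 0" using y_bar_plus_pos[OF assms(1)] \<open>A > 0\<close> by simp
    ultimately show ?thesis by (simp add: zero_less_mult_iff)
  qed
  ultimately show ?thesis using that[of t0] A(1) by (simp add: A_def)
qed

section \<open>Closed orbits\<close>

text \<open>For \<open>y = A sin \<phi>\<close> and \<open>y' = A cos \<phi> \<phi>'\<close>, energy conservation reads
  \<open>\<phi>'\<^sup>2 = stiffness \<eta> A (sin \<phi>)\<close>: the factor \<open>1 - s\<^sup>2\<close> cancels from the difference of potentials.\<close>

definition stiffness :: "real \<Rightarrow> real \<Rightarrow> real \<Rightarrow> real" where
  "stiffness \<eta> A s = 1 - 4 * \<eta>\<^sup>2 - 2 * \<eta> * A * (1 + s\<^sup>2 / (1 + \<bar>s\<bar>)) - A\<^sup>2 / 4 * (1 + s\<^sup>2)"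

text \<open>With \<open>u = \<bar>s\<bar>\<close>, the cubic part of the energy contributes
  \<open>1 - u ^ 3\<close>. Dividing it by \<open>1 - u\<^sup>2\<close> leaves
  \<open>1 + u\<^sup>2 / (1 + u)\<close>, the fraction in \<open>stiffness\<close>; the quadratic
  and quartic parts divide as polynomials.\<close>

lemma energy_diff:
  assumes "A \<ge> 0"
  shows "energy \<eta> A - energy \<eta> (A * s) = A\<^sup>2 * (1 - s\<^sup>2) * stiffness \<eta> A s"
proof -
  define u where "u = \<bar>s\<bar>"
  have u: "u \<ge> 0" "s\<^sup>2 = u\<^sup>2" by (simp_all add: u_def)
  have "(1 - u\<^sup>2) * (1 + u\<^sup>2 / (1 + u)) = (1 - u) * ((1 + u) * (1 + u\<^sup>2 / (1 + u)))"
    by (simp add: power2_eq_square algebra_simps)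
  also have "(1 + u) * (1 + u\<^sup>2 / (1 + u)) = 1 + u + u\<^sup>2" using u by (simp add: distrib_left)
  finally have *: "(1 - u\<^sup>2) * (1 + u\<^sup>2 / (1 + u)) = 1 - u ^ 3"
    by (simp add: power2_eq_square power3_eq_cube algebra_simps)
  have "A\<^sup>2 * (1 - s\<^sup>2) * stiffness \<eta> A s = A\<^sup>2 * (1 - u\<^sup>2) * (1 - 4 * \<eta>\<^sup>2 - A\<^sup>2 / 4 * (1 + u\<^sup>2))
      - 2 * \<eta> * A ^ 3 * ((1 - u\<^sup>2) * (1 + u\<^sup>2 / (1 + u)))"
    unfolding stiffness_def u(2) u_def[symmetric] by algebra
  also have "\<dots> = energy \<eta> A - energy \<eta> (A * s)"
    using assms unfolding * energy_factor abs_mult u_def[symmetric] power_mult_distrib u(2)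
    by (simp add: field_simps power2_eq_square power3_eq_cube)
  finally show ?thesis by simp
qed

lemma stiffness_even_part_bounds:
  fixes s :: real
  assumes "\<bar>s\<bar> \<le> 1" shows "s\<^sup>2 \<le> 1" "0 \<le> s\<^sup>2 / (1 + \<bar>s\<bar>)" "s\<^sup>2 / (1 + \<bar>s\<bar>) \<le> 1 / 2"
proof -
  show "s\<^sup>2 \<le> 1" using assms by (simp add: abs_square_le_1)
  show "0 \<le> s\<^sup>2 / (1 + \<bar>s\<bar>)" by simp
  have "\<bar>s\<bar> * \<bar>s\<bar> \<le> \<bar>s\<bar> * 1" using assms by (intro mult_left_mono) auto
  then have "2 * s\<^sup>2 \<le> 1 + \<bar>s\<bar>" using assms by (simp add: power2_eq_square)
  then show "s\<^sup>2 / (1 + \<bar>s\<bar>) \<le> 1 / 2" by (simp add: divide_simps)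
qed

text \<open>The value is smallest at \<open>\<bar>s\<bar> = 1\<close>, where it equals the bracket
  of \<open>force\<close> at \<open>A\<close>; this is positive below \<open>y_bar\<close>.\<close>

lemma stiffness_pos:
  assumes "\<eta> \<ge> 0" "0 \<le> A" "A < y_bar \<eta>" "\<bar>s\<bar> \<le> 1"
  shows "stiffness \<eta> A s > 0"
proof -
  define r where "r = sqrt (2 + \<eta>\<^sup>2)"
  have r: "r * r = 2 + \<eta> * \<eta>" by (simp add: r_def power2_eq_square)
  have y: "y_bar \<eta> = r - 3 * \<eta>" by (simp add: P_bar_def r_def)
  note b = stiffness_even_part_bounds[OF assms(4)]
  have "(y_bar \<eta> - A) * (A + y_bar \<eta> + 6 * \<eta>) > 0"
    using assms y_bar_plus_pos[OF assms(1)] by (intro mult_pos_pos) auto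
  also have "(y_bar \<eta> - A) * (A + y_bar \<eta> + 6 * \<eta>) = 2 * (1 - 4 * \<eta>\<^sup>2 - 3 * \<eta> * A - A\<^sup>2 / 2)"
    using r unfolding y by algebra
  finally have "0 < 1 - 4 * \<eta>\<^sup>2 - 3 * \<eta> * A - A\<^sup>2 / 2" by simp
  also have "\<dots> = 1 - 4 * \<eta>\<^sup>2 - 2 * \<eta> * A * (1 + 1 / 2) - A\<^sup>2 / 4 * (1 + 1)" by simp
  also have "\<dots> \<le> stiffness \<eta> A s"
    unfolding stiffness_def using assms b by (intro diff_mono mult_left_mono) auto
  finally show ?thesis .
qed

lemma stiffness_strict_decreasing:
  assumes "\<eta> \<ge> 0" "0 \<le> A" "A < A'"
  shows "stiffness \<eta> A' s < stiffness \<eta> A s"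
proof -
  have "2 * \<eta> * A * (1 + s\<^sup>2 / (1 + \<bar>s\<bar>)) \<le> 2 * \<eta> * A' * (1 + s\<^sup>2 / (1 + \<bar>s\<bar>))"
    using assms by (intro mult_right_mono mult_left_mono) (auto intro!: add_nonneg_nonneg)
  moreover have "A\<^sup>2 / 4 * (1 + s\<^sup>2) < A'\<^sup>2 / 4 * (1 + s\<^sup>2)"
    using assms by (intro mult_strict_right_mono) (auto intro!: power_strict_mono add_pos_nonneg)
  ultimately show ?thesis by (simp add: stiffness_def)
qed

lemma has_real_derivative_even_part:
  "((\<lambda>s::real. s\<^sup>2 / (1 + \<bar>s\<bar>)) has_real_derivative s * (2 + \<bar>s\<bar>) / (1 + \<bar>s\<bar>)\<^sup>2) (at s)"
proof -
  consider "s > 0" | "s < 0" | "s = 0" by linarith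
  then show ?thesis
  proof cases
    case 1
    have "((\<lambda>s::real. s\<^sup>2 / (1 + s)) has_real_derivative s * (2 + \<bar>s\<bar>) / (1 + \<bar>s\<bar>)\<^sup>2) (at s)"
      using 1 by (auto intro!: derivative_eq_intros simp: power2_eq_square algebra_simps)
    then show ?thesis
      by (rule has_field_derivative_transform_within_open[where S = "{0<..}"]) (use 1 in auto)
  next
    case 2
    have "((\<lambda>s::real. s\<^sup>2 / (1 - s)) has_real_derivative s * (2 + \<bar>s\<bar>) / (1 + \<bar>s\<bar>)\<^sup>2) (at s)"
      using 2 by (auto intro!: derivative_eq_intros simp: power2_eq_square algebra_simps)
    then show ?thesis
      by (rule has_field_derivative_transform_within_open[where S = "{..<0}"]) (use 2 in auto)
  next
    case 3
    have "((\<lambda>h::real. h / (1 + \<bar>h\<bar>)) \<longlongrightarrow> 0 / (1 + \<bar>0\<bar>)) (at 0)"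
      by (intro tendsto_intros) auto
    then have "((\<lambda>h::real. (h\<^sup>2 / (1 + \<bar>h\<bar>)) / h) \<longlongrightarrow> 0 / (1 + \<bar>0\<bar>)) (at 0)"
      by (rule Lim_transform_eventually) (auto simp: eventually_at_filter power2_eq_square)
    with 3 show ?thesis by (simp add: DERIV_def)
  qed
qed

definition stiffness' :: "real \<Rightarrow> real \<Rightarrow> real \<Rightarrow> real" where
  "stiffness' \<eta> A s = - (2 * \<eta> * A * (s * (2 + \<bar>s\<bar>) / (1 + \<bar>s\<bar>)\<^sup>2)) - A\<^sup>2 / 2 * s"

lemma has_real_derivative_stiffness:
  "(stiffness \<eta> A has_real_derivative stiffness' \<eta> A s) (at s)"
proof -
  have "((\<lambda>s. 1 - 4 * \<eta>\<^sup>2 - 2 * \<eta> * A * (1 + s\<^sup>2 / (1 + \<bar>s\<bar>)) - A\<^sup>2 / 4 * (1 + s\<^sup>2))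
    has_real_derivative 0 - 2 * \<eta> * A * (0 + s * (2 + \<bar>s\<bar>) / (1 + \<bar>s\<bar>)\<^sup>2) - A\<^sup>2 / 4 * (0 + 2 * s))
    (at s)"
    by (intro DERIV_diff DERIV_cmult DERIV_add has_real_derivative_even_part DERIV_const)
      (auto intro!: derivative_eq_intros)
  moreover have "0 - 2 * \<eta> * A * (0 + s * (2 + \<bar>s\<bar>) / (1 + \<bar>s\<bar>)\<^sup>2) - A\<^sup>2 / 4 * (0 + 2 * s)
      = stiffness' \<eta> A s"
    by (simp add: stiffness'_def)
  ultimately show ?thesis by (simp only: stiffness_def[abs_def])
qed

text \<open>For \<open>A > 0\<close> this is \<open>energy_diff\<close> differentiated in
  \<open>s\<close> and divided by \<open>- 2 * A\<close>. The direct algebraic check also covers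
  \<open>A = 0\<close>.\<close>

lemma force_stiffness:
  assumes "A \<ge> 0"
  shows "A * (s * stiffness \<eta> A s - (1 - s\<^sup>2) * stiffness' \<eta> A s / 2) = force \<eta> (A * s)"
proof -
  define u where "u = \<bar>s\<bar>"
  have u: "u \<ge> 0" "s\<^sup>2 = u\<^sup>2" by (simp_all add: u_def)
  have "(1 - u\<^sup>2) * ((2 + u) / (1 + u)\<^sup>2) = (1 - u) * (2 + u) / (1 + u)"
  proof -
    have "(1 - u\<^sup>2) * ((2 + u) / (1 + u)\<^sup>2) = ((1 - u) * (2 + u)) * ((1 + u) / (1 + u)\<^sup>2)"
      by (simp add: power2_eq_square algebra_simps)
    also have "(1 + u) / (1 + u)\<^sup>2 = 1 / (1 + u)" by (simp add: power2_eq_square)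
    finally show ?thesis by simp
  qed
  moreover have "2 * (1 + u\<^sup>2 / (1 + u)) - (1 - u) * (2 + u) / (1 + u) = 3 * u"
  proof -
    have "2 * (1 + u\<^sup>2 / (1 + u)) - (1 - u) * (2 + u) / (1 + u) = (3 * u * (1 + u)) / (1 + u)"
      using u by (simp add: divide_simps) (simp add: algebra_simps power2_eq_square)
    then show ?thesis using u by simp
  qed
  ultimately have *: "2 * (1 + u\<^sup>2 / (1 + u)) - (1 - u\<^sup>2) * ((2 + u) / (1 + u)\<^sup>2) = 3 * u" by simp
  define Q R where "Q = u\<^sup>2 / (1 + u)" and "R = (2 + u) / (1 + u)\<^sup>2"
  define c where "c = A\<^sup>2 / 4"
  have stiff: "stiffness \<eta> A s = 1 - 4 * \<eta>\<^sup>2 - 2 * \<eta> * A * (1 + Q) - c * (1 + u\<^sup>2)"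
    "stiffness' \<eta> A s / 2 = - (\<eta> * A * s * R) - c * s"
    by (simp_all add: stiffness_def stiffness'_def Q_def R_def u_def c_def diff_divide_distrib)
  have "A * (s * stiffness \<eta> A s - (1 - s\<^sup>2) * stiffness' \<eta> A s / 2)
      = A * (s * stiffness \<eta> A s - (1 - u\<^sup>2) * (stiffness' \<eta> A s / 2))"
    by (simp add: u(2))
  also have "\<dots> = A * s * (1 - 4 * \<eta>\<^sup>2 - 2 * c * u\<^sup>2)
      - \<eta> * A\<^sup>2 * s * (2 * (1 + Q) - (1 - u\<^sup>2) * R)"
    unfolding stiff by algebra
  also have "\<dots> = force \<eta> (A * s)"
    using assms unfolding Q_def R_def * force_def abs_mult u_def[symmetric] power_mult_distrib u(2) c_def
    by (simp add: algebra_simps power2_eq_square)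
  finally show ?thesis .
qed

text \<open>The first coordinate is \<open>drift y - y'\<close> for \<open>y = A sin \<phi>\<close>,
  with \<open>y'\<close> computed as if the angle moved at speed
  \<open>\<phi>' = sqrt (stiffness \<eta> A (sin \<phi>))\<close>. The angle thus parametrises a
  closed curve independently of time.\<close>

definition orbit :: "real \<Rightarrow> real \<Rightarrow> real \<Rightarrow> real \<times> real" where
  "orbit \<eta> A \<phi> = (drift \<eta> (A * sin \<phi>) - A * (cos \<phi> * sqrt (stiffness \<eta> A (sin \<phi>))), A * sin \<phi>)"

text \<open>The equation for \<open>y\<close> holds by construction. The equation for
  \<open>x\<close> amounts to \<open>y'' = - force y\<close>, which is
  \<open>force_stiffness\<close>.\<close>

lemma orbit_solution:
  assumes "\<eta> \<ge> 0" "0 \<le> A" "A < y_bar \<eta>"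
    and \<phi>: "\<And>t. (\<phi> has_real_derivative sqrt (stiffness \<eta> A (sin (\<phi> t)))) (at t)"
  shows "mfg_solution \<eta> (\<lambda>t. orbit \<eta> A (\<phi> t))"
  unfolding orbit_def
proof (rule mfg_solutionI)
  fix t
  define s where "s = sin (\<phi> t)"
  define m where "m = stiffness \<eta> A s"
  have m: "m > 0" using stiffness_pos[OF assms(1-3)] by (simp add: m_def s_def)
  have \<phi>t: "(\<phi> has_real_derivative sqrt m) (at t)" using \<phi> by (simp add: m_def s_def)
  have y: "((\<lambda>t. A * sin (\<phi> t)) has_real_derivative A * (cos (\<phi> t) * sqrt m)) (at t)"
    by (auto intro!: derivative_eq_intros \<phi>t)
  then show "((\<lambda>t. A * sin (\<phi> t)) has_real_derivative drift \<eta> (A * sin (\<phi> t)) -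
       (drift \<eta> (A * sin (\<phi> t)) - A * (cos (\<phi> t) * sqrt (stiffness \<eta> A (sin (\<phi> t)))))) (at t)"
    by (simp add: m_def s_def)
  have sinphi: "((\<lambda>t. sin (\<phi> t)) has_real_derivative cos (\<phi> t) * sqrt m) (at t)"
    by (auto intro!: derivative_eq_intros \<phi>t)
  have "((\<lambda>t. stiffness \<eta> A (sin (\<phi> t))) has_real_derivative stiffness' \<eta> A s * (cos (\<phi> t) * sqrt m)) (at t)"
    unfolding s_def by (rule DERIV_chain2[OF has_real_derivative_stiffness sinphi])
  moreover have "(sqrt has_real_derivative inverse (sqrt m) / 2) (at (stiffness \<eta> A (sin (\<phi> t))))"
    using DERIV_real_sqrt[OF m] by (simp add: m_def s_def)
  ultimately have "((\<lambda>t. sqrt (stiffness \<eta> A (sin (\<phi> t)))) has_real_derivative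
      inverse (sqrt m) / 2 * (stiffness' \<eta> A s * (cos (\<phi> t) * sqrt m))) (at t)"
    by (rule DERIV_chain2[rotated])
  \<comment> \<open>The factor \<open>sqrt m\<close> from the angular speed cancels the
    \<open>inverse (sqrt m)\<close> of the square root's derivative.\<close>
  then have w: "((\<lambda>t. sqrt (stiffness \<eta> A (sin (\<phi> t)))) has_real_derivative
      stiffness' \<eta> A s * cos (\<phi> t) / 2) (at t)"
    using m by (simp add: field_simps)
  have "((\<lambda>t. cos (\<phi> t)) has_real_derivative - s * sqrt m) (at t)"
    unfolding s_def by (auto intro!: derivative_eq_intros \<phi>t)
  from DERIV_cmult[OF DERIV_mult[OF this w], of A]
  have v: "((\<lambda>t. A * (cos (\<phi> t) * sqrt (stiffness \<eta> A (sin (\<phi> t))))) has_real_derivative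
      - force \<eta> (A * s)) (at t)"
  proof (rule DERIV_cong)
    have "sqrt (stiffness \<eta> A (sin (\<phi> t))) * sqrt m = m" using m by (simp add: m_def s_def)
    moreover have "cos (\<phi> t) * cos (\<phi> t) = 1 - s\<^sup>2"
      using cos_squared_eq[of "\<phi> t"] by (simp add: s_def power2_eq_square)
    moreover have "A * (- s * sqrt m * sqrt (stiffness \<eta> A (sin (\<phi> t)))
        + stiffness' \<eta> A s * cos (\<phi> t) / 2 * cos (\<phi> t))
      = A * (- s * (sqrt (stiffness \<eta> A (sin (\<phi> t))) * sqrt m)
        + stiffness' \<eta> A s / 2 * (cos (\<phi> t) * cos (\<phi> t)))"
      by (simp add: mult_ac)
    ultimately have "A * (- s * sqrt m * sqrt (stiffness \<eta> A (sin (\<phi> t)))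
        + stiffness' \<eta> A s * cos (\<phi> t) / 2 * cos (\<phi> t)) = A * (- s * m + stiffness' \<eta> A s / 2 * (1 - s\<^sup>2))"
      by (simp only:)
    also have "\<dots> = - force \<eta> (A * s)"
      unfolding force_stiffness[OF assms(2), symmetric] m_def by (simp add: algebra_simps)
    finally show "A * (- s * sqrt m * sqrt (stiffness \<eta> A (sin (\<phi> t)))
        + stiffness' \<eta> A s * cos (\<phi> t) / 2 * cos (\<phi> t)) = - force \<eta> (A * s)" .
  qed
  show "((\<lambda>t. drift \<eta> (A * sin (\<phi> t)) - A * (cos (\<phi> t) * sqrt (stiffness \<eta> A (sin (\<phi> t)))))
      has_real_derivative A * sin (\<phi> t) - (drift \<eta> (A * sin (\<phi> t)) -
        A * (cos (\<phi> t) * sqrt (stiffness \<eta> A (sin (\<phi> t))))) * (\<bar>A * sin (\<phi> t)\<bar> + 2 * \<eta>)) (at t)"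
    by (rule DERIV_cong[OF DERIV_diff[OF DERIV_chain2[OF has_real_derivative_drift y] v]])
      (simp add: m_def s_def force_drift algebra_simps)
qed

lemma orbit_energy:
  assumes "\<eta> \<ge> 0" "0 \<le> A" "A < y_bar \<eta>" and xy: "orbit \<eta> A \<phi> = (x, y)"
  shows "(x - drift \<eta> y)\<^sup>2 + energy \<eta> y = energy \<eta> A"
proof -
  have m: "stiffness \<eta> A (sin \<phi>) > 0" using assms by (intro stiffness_pos) auto
  have "(x - drift \<eta> y)\<^sup>2 = (A * (cos \<phi> * sqrt (stiffness \<eta> A (sin \<phi>))))\<^sup>2"
    using xy by (auto simp: orbit_def power2_eq_square)
  also have "\<dots> = A\<^sup>2 * (1 - (sin \<phi>)\<^sup>2) * stiffness \<eta> A (sin \<phi>)"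
    using m by (simp add: power_mult_distrib cos_squared_eq)
  also have "\<dots> = energy \<eta> A - energy \<eta> y"
    using xy energy_diff[OF assms(2), of \<eta> "sin \<phi>"] by (simp add: orbit_def)
  finally show ?thesis by simp
qed

text \<open>The energy fixes \<open>x - drift \<eta> y\<close> up to sign. The angles
  \<open>p\<close> and \<open>pi - p\<close> have the same sine and opposite cosines, so they
  realise both signs.\<close>

lemma orbit_covers_level_set:
  assumes "\<eta> \<ge> 0" "0 < A" "A < y_bar \<eta>" "\<bar>y\<bar> \<le> A"
    and E: "(x - drift \<eta> y)\<^sup>2 + energy \<eta> y = energy \<eta> A"
  obtains \<phi> where "orbit \<eta> A \<phi> = (x, y)"
proof -
  define p where "p = arcsin (y / A)"
  have s: "A * sin p = y" using assms by (simp add: p_def abs_le_iff divide_simps)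
  define v where "v = A * (cos p * sqrt (stiffness \<eta> A (sin p)))"
  have "orbit \<eta> A p = (drift \<eta> y - v, y)" by (simp add: orbit_def s v_def)
  from orbit_energy[OF assms(1) _ assms(3) this] assms(2) E
  have "(x - drift \<eta> y)\<^sup>2 = v\<^sup>2" by simp
  then consider "x = drift \<eta> y - v" | "x = drift \<eta> y + v" by (auto simp: power2_eq_iff)
  then show ?thesis
  proof cases
    case 1
    then show ?thesis using that[of p] by (simp add: orbit_def s v_def)
  next
    case 2
    then show ?thesis using that[of "pi - p"] by (simp add: orbit_def s v_def)
  qed
qed

section \<open>The period as a function of the amplitude\<close>

text \<open>Separation of variables: \<open>\<tau>\<close>, the primitive of \<open>1 / w\<close>
  vanishing at 0, is the time needed to reach an angle, and \<open>\<phi>\<close> is its inverse.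
  Periodicity of \<open>w\<close> makes \<open>\<tau> (x + 2 * pi) - \<tau> x\<close> constant,
  which gives the time of a full turn.\<close>

lemma angle_equation:
  fixes w :: "real \<Rightarrow> real"
  assumes cont: "continuous_on UNIV w" and pos: "\<And>p. 0 < w p" and le: "\<And>p. w p \<le> W"
    and per: "\<And>p. w (p + 2 * pi) = w p"
  obtains \<phi> where "\<And>t. (\<phi> has_real_derivative w (\<phi> t)) (at t)" "\<phi> 0 = 0" "surj \<phi>"
    "\<And>t. \<phi> (t + integral {0..2 * pi} (\<lambda>p. 1 / w p)) = \<phi> t + 2 * pi"
proof -
  have W: "W > 0" using pos[of 0] le[of 0] by linarith
  have "isCont (\<lambda>p. 1 / w p) x" for x
    using cont pos[of x] by (intro continuous_intros) (auto simp: continuous_on_eq_continuous_at)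
  then obtain F where F: "(F has_real_derivative 1 / w x) (at x)" for x
    using einterval_antiderivative[of "-\<infinity>" "\<infinity>" "\<lambda>p. 1 / w p"]
    by (auto simp: has_real_derivative_iff_has_vector_derivative)
  define \<tau> where "\<tau> x = F x - F 0" for x
  have d\<tau>: "(\<tau> has_real_derivative 1 / w x) (at x)" for x
    unfolding \<tau>_def using DERIV_diff[OF F DERIV_const] by simp
  have cont\<tau>: "continuous_on S \<tau>" for S
    using d\<tau> DERIV_isCont continuous_at_imp_continuous_on by blast
  have mono: "\<tau> x < \<tau> y" if "x < y" for x y
    using that d\<tau> pos by (intro DERIV_pos_imp_increasing[of x y \<tau>]) (auto intro!: exI)
  \<comment> \<open>The slope of \<open>\<tau>\<close> is at least \<open>1 / W\<close>, so
    \<open>\<tau>\<close> takes every real value and \<open>\<phi>\<close> is defined for all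
    times.\<close>
  have growth: "\<tau> x - x / W \<le> \<tau> y - y / W" if "x \<le> y" for x y
  proof (rule DERIV_nonneg_imp_nondecreasing[OF that])
    fix s
    have "((\<lambda>x. \<tau> x - x / W) has_real_derivative 1 / w s - 1 / W) (at s)"
      using W by (auto intro!: derivative_eq_intros d\<tau>)
    moreover have "1 / w s - 1 / W \<ge> 0" using pos[of s] le[of s] W by (simp add: frac_le)
    ultimately show "\<exists>y. ((\<lambda>x. \<tau> x - x / W) has_real_derivative y) (at s) \<and> 0 \<le> y" by blast
  qed
  have "\<exists>x. \<tau> x = t" for t
  proof -
    have "0 \<le> \<bar>t\<bar> * W" using W by simp
    with growth[of 0 "\<bar>t\<bar> * W"] growth[of "- (\<bar>t\<bar> * W)" 0] W
    have "\<tau> (- (\<bar>t\<bar> * W)) \<le> t" "t \<le> \<tau> (\<bar>t\<bar> * W)" by (auto simp: \<tau>_def)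
    then show ?thesis using IVT'[of \<tau> "- (\<bar>t\<bar> * W)" t "\<bar>t\<bar> * W"] cont\<tau> \<open>0 \<le> \<bar>t\<bar> * W\<close> by fastforce
  qed
  then have surj: "surj \<tau>" unfolding surj_def by metis
  have inj: "inj \<tau>" using mono by (metis injI linorder_neq_iff)
  define \<phi> where "\<phi> = inv \<tau>"
  have \<tau>\<phi>: "\<tau> (\<phi> t) = t" and \<phi>\<tau>: "\<phi> (\<tau> x) = x" for t x
    using surj inj by (simp_all add: \<phi>_def surj_f_inv_f)
  have "surj \<phi>" using \<phi>\<tau> by (rule surjI)
  have "continuous_on UNIV \<phi>"
  proof (rule continuous_onI_mono)
    show "open (range \<phi>)" using \<open>surj \<phi>\<close> by simp
    show "\<phi> x \<le> \<phi> y" if "x \<le> y" for x y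
      using mono[of "\<phi> y" "\<phi> x"] that by (auto simp: \<tau>\<phi> not_le[symmetric])
  qed
  then have "isCont \<phi> t" for t by (simp add: continuous_on_eq_continuous_at)
  then have "(\<phi> has_real_derivative inverse (1 / w (\<phi> t))) (at t)" for t
    using pos[of "\<phi> t"]
    by (intro DERIV_inverse_function[where f = \<tau> and a = "t - 1" and b = "t + 1"])
      (auto simp: \<tau>\<phi> intro!: d\<tau>)
  then have d\<phi>: "(\<phi> has_real_derivative w (\<phi> t)) (at t)" for t by simp
  have "\<phi> 0 = 0" using \<phi>\<tau>[of 0] by (simp add: \<tau>_def)
  have "((\<lambda>p. 1 / w p) has_integral \<tau> (2 * pi) - \<tau> 0) {0..2 * pi}"
    using d\<tau> by (intro fundamental_theorem_of_calculus)
      (auto simp: has_real_derivative_iff_has_vector_derivative[symmetric] intro: DERIV_subset)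
  then have int: "integral {0..2 * pi} (\<lambda>p. 1 / w p) = \<tau> (2 * pi)"
    by (simp add: integral_unique \<tau>_def)
  have "((\<lambda>x. \<tau> (x + 2 * pi) - \<tau> x) has_real_derivative 0) (at x)" for x
    using DERIV_diff[OF d\<tau>[of "x + 2 * pi", THEN DERIV_shift[THEN iffD1]] d\<tau>[of x]] per by simp
  then have "\<tau> (x + 2 * pi) - \<tau> x = \<tau> (0 + 2 * pi) - \<tau> 0" for x
    by (intro DERIV_isconst_all[where f = "\<lambda>x. \<tau> (x + 2 * pi) - \<tau> x"] allI)
  then have "\<tau> (x + 2 * pi) = \<tau> x + \<tau> (2 * pi)" for x by (simp add: \<tau>_def algebra_simps)
  from this[of "\<phi> t" for t] have "\<phi> (t + \<tau> (2 * pi)) = \<phi> t + 2 * pi" for t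
    by (metis \<tau>\<phi> \<phi>\<tau>)
  then show ?thesis using that[of \<phi>] d\<phi> \<open>\<phi> 0 = 0\<close> \<open>surj \<phi>\<close> int by simp
qed

definition orbit_period :: "real \<Rightarrow> real \<Rightarrow> real" where
  "orbit_period \<eta> A = integral {0..2 * pi} (\<lambda>p. 1 / sqrt (stiffness \<eta> A (sin p)))"

lemma continuous_on_stiffness [continuous_intros]:
  fixes f g :: "'a::topological_space \<Rightarrow> real"
  assumes "continuous_on S f" "continuous_on S g"
  shows "continuous_on S (\<lambda>x. stiffness \<eta> (f x) (g x))"
  unfolding stiffness_def using assms by (intro continuous_intros) auto

text \<open>For \<open>\<eta> < 1/2\<close> this is the period of the linearisation at the origin.
  It is the lower end of the range of periods, approached as the amplitude tends to 0.\<close>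

lemma orbit_period_0: "orbit_period \<eta> 0 = 2 * pi / sqrt (1 - 4 * \<eta>\<^sup>2)"
  by (simp add: orbit_period_def stiffness_def)

lemma orbit_period_continuous:
  assumes "\<eta> \<ge> 0" shows "continuous_on {0..<y_bar \<eta>} (orbit_period \<eta>)"
proof -
  have "continuous_on ({0..<y_bar \<eta>} \<times> cbox 0 (2 * pi))
      (\<lambda>(A, p). 1 / sqrt (stiffness \<eta> A (sin p)))"
    unfolding case_prod_beta using stiffness_pos[OF assms]
    by (intro continuous_intros) (fastforce simp: less_imp_neq[symmetric])
  from integral_continuous_on_param[OF this] show ?thesis
    by (simp add: orbit_period_def[abs_def])
qed

lemma orbit_period_integrand_continuous:
  assumes "\<eta> \<ge> 0" "0 \<le> A" "A < y_bar \<eta>"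
  shows "continuous_on S (\<lambda>p. 1 / sqrt (stiffness \<eta> A (sin p)))"
  using stiffness_pos[OF assms] by (intro continuous_intros) (auto simp: less_imp_neq[symmetric])

lemma orbit_period_strict_mono:
  assumes "\<eta> \<ge> 0" "0 \<le> A" "A < A'" "A' < y_bar \<eta>"
  shows "orbit_period \<eta> A < orbit_period \<eta> A'"
  unfolding orbit_period_def
proof (rule integral_less_real)
  fix p
  have "stiffness \<eta> A' (sin p) > 0" using assms by (intro stiffness_pos) auto
  then show "1 / sqrt (stiffness \<eta> A (sin p)) < 1 / sqrt (stiffness \<eta> A' (sin p))"
    using stiffness_strict_decreasing[OF assms(1-3), of "sin p"]
    by (intro divide_strict_left_mono mult_pos_pos) auto
next
  have "pi \<in> {0<..<2 * pi}" by simp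
  then show "{0<..<2 * pi} \<noteq> {}" by blast
qed (use assms in \<open>auto intro!: orbit_period_integrand_continuous\<close>)

section \<open>Divergence of the period at the saddle\<close>

lemma stiffness_1: "stiffness \<eta> A 1 = (y_bar \<eta> - A) * (A + y_bar \<eta> + 6 * \<eta>) / 2"
proof -
  define r where "r = sqrt (2 + \<eta>\<^sup>2)"
  have r: "r * r = 2 + \<eta> * \<eta>" by (simp add: r_def power2_eq_square)
  have y: "y_bar \<eta> = r - 3 * \<eta>" by (simp add: P_bar_def r_def)
  have "(y_bar \<eta> - A) * (A + y_bar \<eta> + 6 * \<eta>) = 2 * (1 - 4 * \<eta>\<^sup>2 - 3 * \<eta> * A - A\<^sup>2 / 2)"
    using r unfolding y by algebra
  then show ?thesis by (simp add: stiffness_def)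
qed

text \<open>Near the top of the orbit the angle passes a bottleneck: its squared speed exceeds the value
  at the top, which vanishes as the orbit approaches the saddle, by at most a quadratic term.\<close>

lemma stiffness_bottleneck:
  assumes "\<eta> \<ge> 0" "0 \<le> A" "A < y_bar \<eta>" "0 \<le> sin p"
  shows "sqrt (stiffness \<eta> A (sin p)) \<le> sqrt (stiffness \<eta> A 1) + \<bar>p - pi / 2\<bar>"
proof -
  define s where "s = sin p"
  have s: "0 \<le> s" "s \<le> 1" using assms(4) by (auto simp: s_def)
  have pos: "stiffness \<eta> A 1 > 0" using stiffness_pos[OF assms(1-3)] by simp
  have "1 - 4 * \<eta>\<^sup>2 - 3 * (\<eta> * A) - A\<^sup>2 / 2 > 0" using pos by (simp add: stiffness_def mult.commute)
  moreover have "\<eta> * A \<ge> 0" "\<eta>\<^sup>2 \<ge> 0" "A\<^sup>2 \<ge> 0" using assms by auto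
  \<comment> \<open>Positivity of the stiffness at the top bounds these coefficients, so the
    quadratic term below gets the constant 1 for every \<open>A\<close>.\<close>
  ultimately have c: "\<eta> * A + A\<^sup>2 / 4 \<le> 1" by linarith
  have 1: "1 / 2 - s\<^sup>2 / (1 + s) \<le> 1 - s"
    using s by (simp add: divide_simps) (simp add: algebra_simps power2_eq_square)
  have 2: "1 - s\<^sup>2 \<le> 2 * (1 - s)"
    using zero_le_power2[of "1 - s"] by (simp add: power2_eq_square algebra_simps)
  have "stiffness \<eta> A s - stiffness \<eta> A 1
      = 2 * (\<eta> * A) * (1 / 2 - s\<^sup>2 / (1 + s)) + A\<^sup>2 / 4 * (1 - s\<^sup>2)"
    using s by (simp add: stiffness_def field_simps)
  also have "\<dots> \<le> 2 * (\<eta> * A) * (1 - s) + A\<^sup>2 / 4 * (2 * (1 - s))"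
    using assms 1 2 by (intro add_mono mult_left_mono) auto
  also have "\<dots> = (\<eta> * A + A\<^sup>2 / 4) * (2 * (1 - s))" by (simp add: algebra_simps)
  also have "\<dots> \<le> 1 * (2 * (1 - s))" using c s by (intro mult_right_mono) auto
  \<comment> \<open>The half-angle formula turns \<open>2 * (1 - s)\<close> into four times a
    squared sine, and the sine is bounded by its argument.\<close>
  also have "\<dots> \<le> (p - pi / 2)\<^sup>2"
  proof -
    have "s = cos (p - pi / 2)" by (simp add: s_def cos_diff)
    also have "\<dots> = cos (2 * ((p - pi / 2) / 2))" by (rule arg_cong[where f = cos]) argo
    also have "\<dots> = 1 - 2 * (sin ((p - pi / 2) / 2))\<^sup>2" by (rule cos_double_sin)
    finally have "2 * (1 - s) = 4 * (sin ((p - pi / 2) / 2))\<^sup>2" by simp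
    also have "\<dots> \<le> 4 * ((p - pi / 2) / 2)\<^sup>2"
      using abs_sin_x_le_abs_x by (intro mult_left_mono) (auto simp: abs_le_square_iff)
    finally show ?thesis by (simp add: power_divide)
  qed
  finally have "stiffness \<eta> A s \<le> stiffness \<eta> A 1 + (p - pi / 2)\<^sup>2" by simp
  also have "\<dots> \<le> (sqrt (stiffness \<eta> A 1) + \<bar>p - pi / 2\<bar>)\<^sup>2"
    using pos by (simp add: power2_sum)
  finally show ?thesis unfolding s_def using pos by (intro real_le_lsqrt) auto
qed

text \<open>On the quarter turn after the top the integrand is at least
  \<open>1 / (d + (p - pi / 2))\<close>. Its integral is \<open>ln (d + pi / 2) - ln d\<close>,
  whose first term is nonnegative.\<close>

lemma orbit_period_ge:
  assumes "\<eta> \<ge> 0" "0 \<le> A" "A < y_bar \<eta>"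
  shows "orbit_period \<eta> A \<ge> - ln (sqrt (stiffness \<eta> A 1))"
proof -
  define d where "d = sqrt (stiffness \<eta> A 1)"
  have d: "d > 0" using stiffness_pos[OF assms] by (simp add: d_def)
  let ?f = "\<lambda>p. 1 / sqrt (stiffness \<eta> A (sin p))"
  have int: "?f integrable_on {a..b}" for a b
    using orbit_period_integrand_continuous[OF assms] integrable_continuous_real by blast
  have lower: "((\<lambda>p. 1 / (d + (p - pi / 2))) has_integral
      ln (d + (pi - pi / 2)) - ln (d + (pi / 2 - pi / 2))) {pi / 2..pi}"
  proof (rule fundamental_theorem_of_calculus)
    fix p assume "p \<in> {pi / 2..pi}"
    then have "d + (p - pi / 2) > 0" using d by auto
    then have "((\<lambda>p. ln (d + (p - pi / 2))) has_real_derivative 1 / (d + (p - pi / 2))) (at p)"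
      by (auto intro!: derivative_eq_intros)
    then show "((\<lambda>p. ln (d + (p - pi / 2))) has_vector_derivative 1 / (d + (p - pi / 2)))
        (at p within {pi / 2..pi})"
      by (simp add: has_real_derivative_iff_has_vector_derivative has_vector_derivative_at_within)
  qed simp
  have "0 \<le> ln (d + pi / 2)" using d pi_ge_two by (intro ln_ge_zero) auto
  then have "- ln d \<le> ln (d + (pi - pi / 2)) - ln (d + (pi / 2 - pi / 2))" by (simp add: field_simps)
  also have "\<dots> \<le> integral {pi / 2..pi} ?f"
  proof (rule has_integral_le[OF lower integrable_integral[OF int]])
    fix p assume p: "p \<in> {pi / 2..pi}"
    then have "0 \<le> sin p" by (intro sin_ge_zero) (use pi_ge_two in auto)
    then have "sqrt (stiffness \<eta> A (sin p)) \<le> d + \<bar>p - pi / 2\<bar>"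
      using stiffness_bottleneck[OF assms] by (simp add: d_def)
    then show "1 / (d + (p - pi / 2)) \<le> ?f p"
      using p stiffness_pos[OF assms, of "sin p"] by (intro divide_left_mono mult_pos_pos) (use d in auto)
  qed
  also have "\<dots> \<le> integral {0..2 * pi} ?f"
  proof (rule integral_subset_le[OF _ int int])
    show "\<forall>x\<in>{0..2 * pi}. 0 \<le> ?f x"
      using stiffness_pos[OF assms] by (auto intro!: real_sqrt_ge_zero less_imp_le)
  qed (use pi_gt_zero in auto)
  finally show ?thesis by (simp add: orbit_period_def d_def)
qed

lemma orbit_period_unbounded:
  assumes "\<eta> \<ge> 0" "\<eta> < 1 / 2"
  obtains A where "0 < A" "A < y_bar \<eta>" "orbit_period \<eta> A > K"
proof -
  have y: "y_bar \<eta> > 0" using y_bar_pos_iff assms by simp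
  have "isCont (\<lambda>A. sqrt (stiffness \<eta> A 1)) (y_bar \<eta>)"
    unfolding stiffness_1 by (intro continuous_intros) auto
  then have "((\<lambda>A. sqrt (stiffness \<eta> A 1)) \<longlongrightarrow> 0) (at_left (y_bar \<eta>))"
    by (simp add: isCont_def stiffness_1 filterlim_at_split)
  \<comment> \<open>The threshold \<open>exp (- K)\<close> for the speed at the top makes the bound
    of \<open>orbit_period_ge\<close> exceed \<open>K\<close>.\<close>
  then have "\<forall>\<^sub>F A in at_left (y_bar \<eta>). sqrt (stiffness \<eta> A 1) < exp (- K)"
    by (rule order_tendstoD) simp
  moreover have "\<forall>\<^sub>F A in at_left (y_bar \<eta>). A \<in> {0<..<y_bar \<eta>}"
    using y by (rule eventually_at_left_real)
  ultimately have "\<forall>\<^sub>F A in at_left (y_bar \<eta>). sqrt (stiffness \<eta> A 1) < exp (- K) \<and> A \<in> {0<..<y_bar \<eta>}"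
    by eventually_elim auto
  then obtain A where A: "sqrt (stiffness \<eta> A 1) < exp (- K)" "0 < A" "A < y_bar \<eta>"
    using eventually_happens'[OF trivial_limit_at_left_real] by auto
  have "ln (sqrt (stiffness \<eta> A 1)) < - K"
    using A stiffness_pos[OF assms(1), of A 1] ln_less_cancel_iff[of "sqrt (stiffness \<eta> A 1)" "exp (- K)"]
    by simp
  then have "orbit_period \<eta> A > K"
    using orbit_period_ge[OF assms(1), of A] A by linarith
  with A that show ?thesis by blast
qed

lemma orbit_period_image:
  assumes "\<eta> \<ge> 0" "\<eta> < 1 / 2"
  shows "orbit_period \<eta> ` {0<..<y_bar \<eta>} = {2 * pi / sqrt (1 - 4 * \<eta>\<^sup>2)<..}"
  unfolding orbit_period_0[symmetric]
proof
  show "orbit_period \<eta> ` {0<..<y_bar \<eta>} \<subseteq> {orbit_period \<eta> 0<..}"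
    using orbit_period_strict_mono[OF assms(1), of 0] by auto
  show "{orbit_period \<eta> 0<..} \<subseteq> orbit_period \<eta> ` {0<..<y_bar \<eta>}"
  proof
    fix t assume t: "t \<in> {orbit_period \<eta> 0<..}"
    obtain A where A: "0 < A" "A < y_bar \<eta>" "orbit_period \<eta> A > t"
      using orbit_period_unbounded[OF assms] .
    have "continuous_on {0..A} (orbit_period \<eta>)"
      using A by (intro continuous_on_subset[OF orbit_period_continuous[OF assms(1)]]) auto
    then obtain B where "0 \<le> B" "B \<le> A" "orbit_period \<eta> B = t"
      using IVT'[of "orbit_period \<eta>" 0 t A] A t by auto
    moreover have "B \<noteq> 0" using calculation t by auto
    ultimately show "t \<in> orbit_period \<eta> ` {0<..<y_bar \<eta>}" using A by auto
  qed
qed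

section \<open>The peak of the first coordinate\<close>

lemma energy_strict_mono:
  assumes "\<eta> \<ge> 0" "0 \<le> A" "A < A'" "A' \<le> y_bar \<eta>"
  shows "energy \<eta> A < energy \<eta> A'"
proof (rule DERIV_pos_imp_increasing_open[OF assms(3)])
  fix y assume y: "A < y" "y < A'"
  have "y * (y_bar \<eta> - \<bar>y\<bar>) * (\<bar>y\<bar> + y_bar \<eta> + 6 * \<eta>) / 2 > 0"
    using y assms y_bar_plus_pos[OF assms(1)] by (intro divide_pos_pos mult_pos_pos) auto
  then have "2 * force \<eta> y > 0" unfolding force_factor by simp
  then show "\<exists>d. (energy \<eta> has_real_derivative d) (at y) \<and> d > 0"
    using has_real_derivative_energy by blast
qed (meson DERIV_isCont continuous_at_imp_continuous_on has_real_derivative_energy)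

text \<open>Twice the minimum over \<open>y\<close> of the Hamiltonian
  \<open>((x - drift \<eta> y)\<^sup>2 + energy \<eta> y) / 2\<close> at fixed \<open>x = a\<close>; it is attained where \<open>x\<close> is stationary.\<close>

definition peak_energy :: "real \<Rightarrow> real \<Rightarrow> real" where
  "peak_energy \<eta> a = a\<^sup>2 * (1 - 4 * \<eta>\<^sup>2 / (1 - a))"

text \<open>The squares of \<open>drift\<close> cancel, so for \<open>y >= 0\<close> the left side
  is quadratic in \<open>y\<close> with leading coefficient \<open>1 - a\<close>. The minimiser
  solves \<open>y - a * (y + 2 * \<eta>) = 0\<close>, the condition that \<open>x\<close> is
  stationary.\<close>

lemma hamiltonian_complete_square:
  assumes "0 \<le> y" "a < 1"
  shows "(a - drift \<eta> y)\<^sup>2 + energy \<eta> y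
    = (1 - a) * (y - 2 * \<eta> * a / (1 - a))\<^sup>2 + peak_energy \<eta> a"
proof -
  define q where "q = 2 * \<eta> * a / (1 - a)"
  have q: "(1 - a) * q = 2 * \<eta> * a" using assms by (simp add: q_def)
  have "peak_energy \<eta> a = a\<^sup>2 - 2 * \<eta> * a * q"
    by (simp add: peak_energy_def q_def right_diff_distrib power2_eq_square)
  moreover have "(a - drift \<eta> y)\<^sup>2 + energy \<eta> y = a\<^sup>2 - a * y\<^sup>2 - 4 * \<eta> * a * y + y\<^sup>2"
    using assms by (simp add: energy_def drift_def power2_eq_square algebra_simps)
  ultimately show ?thesis using q unfolding q_def[symmetric] by algebra
qed

lemma peak_energy_le:
  assumes "0 \<le> a" "a < 1" "\<eta> \<ge> 0"
  shows "peak_energy \<eta> a \<le> (a - drift \<eta> y)\<^sup>2 + energy \<eta> y"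
proof (cases "0 \<le> y")
  case True
  then show ?thesis using hamiltonian_complete_square[OF True assms(2)] assms by simp
next
  case False
  \<comment> \<open>For negative \<open>y\<close> the left side is at most \<open>a\<^sup>2\<close>,
    and every further term of the Hamiltonian is nonnegative.\<close>
  have "peak_energy \<eta> a \<le> a\<^sup>2 * 1"
    unfolding peak_energy_def using assms by (intro mult_left_mono) auto
  also have "\<dots> \<le> a\<^sup>2 + ((1 + a) * y\<^sup>2 + 4 * \<eta> * a * (- y))"
  proof -
    have "(1 + a) * y\<^sup>2 \<ge> 0" "4 * \<eta> * a * (- y) \<ge> 0"
      using assms False by (intro mult_nonneg_nonneg; simp)+
    then show ?thesis by linarith
  qed
  also have "\<dots> = (a - drift \<eta> y)\<^sup>2 + energy \<eta> y"
    using False by (simp add: energy_def drift_def power2_eq_square algebra_simps)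
  finally show ?thesis .
qed

lemma x_bar_le_1: assumes "\<eta> \<ge> 0" shows "x_bar \<eta> \<le> 1"
proof -
  have "0 \<le> \<eta>\<^sup>2" "0 \<le> \<eta> * sqrt (2 + \<eta>\<^sup>2)" using assms by simp_all
  then show ?thesis unfolding P_bar_def fst_conv by linarith
qed

lemma x_bar_less_1: assumes "\<eta> > 0" shows "x_bar \<eta> < 1"
proof -
  have "0 < \<eta>\<^sup>2" "0 \<le> \<eta> * sqrt (2 + \<eta>\<^sup>2)" using assms by simp_all
  then show ?thesis unfolding P_bar_def fst_conv by linarith
qed

lemma x_bar_pos:
  assumes "\<eta> \<ge> 0" "\<eta> < 1 / 2" shows "x_bar \<eta> > 0"
  unfolding drift_y_bar[OF assms, symmetric] drift_def
  using y_bar_pos_iff[OF assms(1)] assms by (intro add_pos_nonneg divide_pos_pos mult_pos_pos) auto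

lemma y_bar_x_bar: "y_bar \<eta> * (1 - x_bar \<eta>) = 2 * \<eta> * x_bar \<eta>"
proof -
  define r where "r = sqrt (2 + \<eta>\<^sup>2)"
  have "r * r = 2 + \<eta> * \<eta>" by (simp add: r_def power2_eq_square)
  moreover have "y_bar \<eta> = r - 3 * \<eta>" "x_bar \<eta> = 1 - \<eta> * \<eta> - \<eta> * r"
    by (simp_all add: P_bar_def r_def power2_eq_square)
  ultimately show ?thesis by algebra
qed

text \<open>For \<open>\<eta> > 0\<close> the pole at 1 lies beyond \<open>x_bar\<close>. For
  \<open>\<eta> = 0\<close> one has \<open>x_bar = 1\<close>, but the numerator of the fraction
  vanishes and the function is \<open>a\<^sup>2\<close>.\<close>

lemma peak_energy_continuous:
  assumes "\<eta> \<ge> 0" shows "continuous_on {0..x_bar \<eta>} (peak_energy \<eta>)"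
proof (cases "\<eta> = 0")
  case True
  then show ?thesis unfolding peak_energy_def by (auto intro!: continuous_intros)
next
  case False
  then show ?thesis unfolding peak_energy_def using x_bar_less_1[of \<eta>] assms
    by (auto intro!: continuous_intros)
qed

text \<open>In terms of \<open>r = 1 - x\<close>, the sign of the derivative is that of a quadratic
  with root \<open>k = 1 - x_bar\<close>. Before the saddle \<open>r > k\<close>, and
  \<open>k >= \<eta>\<^sup>2\<close> makes the other factor positive.\<close>

lemma peak_energy_strict_mono:
  assumes "\<eta> \<ge> 0" "0 \<le> a" "a < a'" "a' \<le> x_bar \<eta>"
  shows "peak_energy \<eta> a < peak_energy \<eta> a'"
proof (rule DERIV_pos_imp_increasing_open[OF assms(3)])
  fix x assume x: "a < x" "x < a'"
  have x01: "0 < x" "x < 1" using x assms x_bar_le_1[OF assms(1)] by auto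
  define r where "r = 1 - x"
  define k where "k = 1 - x_bar \<eta>"
  have r: "r > 0" using x01 by (simp add: r_def)
  have k: "k\<^sup>2 = 2 * \<eta>\<^sup>2 * k + 2 * \<eta>\<^sup>2" "k \<ge> \<eta>\<^sup>2" "r > k"
  proof -
    define q where "q = sqrt (2 + \<eta>\<^sup>2)"
    have q: "q * q = 2 + \<eta> * \<eta>" by (simp add: q_def power2_eq_square)
    have k: "k = \<eta> * \<eta> + \<eta> * q" by (simp add: k_def P_bar_def q_def power2_eq_square)
    show "k\<^sup>2 = 2 * \<eta>\<^sup>2 * k + 2 * \<eta>\<^sup>2" using q unfolding k by algebra
    show "k \<ge> \<eta>\<^sup>2" using assms(1) by (simp add: k q_def power2_eq_square)
    show "r > k" using x assms by (simp add: r_def k_def)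
  qed
  have "(r - k) * (r + k - 2 * \<eta>\<^sup>2) > 0" using k by (intro mult_pos_pos) auto
  also have "(r - k) * (r + k - 2 * \<eta>\<^sup>2) = r\<^sup>2 - 2 * \<eta>\<^sup>2 * r - 2 * \<eta>\<^sup>2" using k(1) by algebra
  finally have pos: "r\<^sup>2 - 2 * \<eta>\<^sup>2 * r - 2 * \<eta>\<^sup>2 > 0" .
  have "(peak_energy \<eta> has_real_derivative
      2 * x * (1 - 4 * \<eta>\<^sup>2 / (1 - x)) - x\<^sup>2 * (4 * \<eta>\<^sup>2 / (1 - x)\<^sup>2)) (at x)"
    unfolding peak_energy_def[abs_def] using x01
    by (auto intro!: derivative_eq_intros simp: power2_eq_square)
  also have "2 * x * (1 - 4 * \<eta>\<^sup>2 / (1 - x)) - x\<^sup>2 * (4 * \<eta>\<^sup>2 / (1 - x)\<^sup>2)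
      = 2 * x / r\<^sup>2 * (r\<^sup>2 - 2 * \<eta>\<^sup>2 * r - 2 * \<eta>\<^sup>2)"
  proof -
    have x: "x = 1 - r" by (simp add: r_def)
    show ?thesis unfolding r_def[symmetric] using r
      by (simp add: divide_simps) (simp add: x algebra_simps power2_eq_square)
  qed
  finally have "(peak_energy \<eta> has_real_derivative
      2 * x / r\<^sup>2 * (r\<^sup>2 - 2 * \<eta>\<^sup>2 * r - 2 * \<eta>\<^sup>2)) (at x)" .
  moreover have "2 * x / r\<^sup>2 * (r\<^sup>2 - 2 * \<eta>\<^sup>2 * r - 2 * \<eta>\<^sup>2) > 0"
    using x01 r pos by (intro mult_pos_pos divide_pos_pos) auto
  ultimately show "\<exists>d. (peak_energy \<eta> has_real_derivative d) (at x) \<and> d > 0" by blast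
qed (use assms in \<open>auto intro: continuous_on_subset[OF peak_energy_continuous]\<close>)

text \<open>At the saddle the minimiser is \<open>y_bar\<close> and the velocity term vanishes. The
  case \<open>\<eta> = 0\<close> is computed directly because \<open>1 - x_bar\<close> is then
  0.\<close>

lemma peak_energy_x_bar:
  assumes "\<eta> \<ge> 0" "\<eta> < 1 / 2" shows "peak_energy \<eta> (x_bar \<eta>) = energy \<eta> (y_bar \<eta>)"
proof (cases "\<eta> = 0")
  case True
  then show ?thesis by (simp add: peak_energy_def energy_def drift_def P_bar_def)
next
  case False
  have "2 * \<eta> * x_bar \<eta> / (1 - x_bar \<eta>) = y_bar \<eta>"
    using y_bar_x_bar[of \<eta>] x_bar_less_1[of \<eta>] assms False by (simp add: divide_simps)
  then show ?thesis
    using hamiltonian_complete_square[of "y_bar \<eta>" "x_bar \<eta>" \<eta>] drift_y_bar[OF assms]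
      x_bar_less_1[of \<eta>] y_bar_pos_iff[of \<eta>] assms False by simp
qed

text \<open>Both \<open>energy\<close> on \<open>[0, y_bar]\<close> and \<open>peak_energy\<close>
  on \<open>[0, x_bar]\<close> increase from 0 to the energy of the saddle. Equating them pairs each
  peak of \<open>x\<close> with one amplitude of \<open>y\<close>.\<close>

lemma amplitude_of_peak:
  assumes "\<eta> \<ge> 0" "\<eta> < 1 / 2" "0 < a" "a < x_bar \<eta>"
  shows "\<exists>!A. 0 < A \<and> A < y_bar \<eta> \<and> energy \<eta> A = peak_energy \<eta> a"
proof (rule ex_ex1I)
  have lo: "energy \<eta> 0 < peak_energy \<eta> a"
    using peak_energy_strict_mono[of \<eta> 0 a] assms by (simp add: energy_def drift_def peak_energy_def)
  have hi: "peak_energy \<eta> a < energy \<eta> (y_bar \<eta>)"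
    using peak_energy_strict_mono[of \<eta> a "x_bar \<eta>"] assms peak_energy_x_bar by simp
  have "continuous_on {0..y_bar \<eta>} (energy \<eta>)"
    by (meson DERIV_isCont continuous_at_imp_continuous_on has_real_derivative_energy)
  then obtain A where A: "0 \<le> A" "A \<le> y_bar \<eta>" "energy \<eta> A = peak_energy \<eta> a"
    using IVT'[of "energy \<eta>" 0 "peak_energy \<eta> a" "y_bar \<eta>"] lo hi y_bar_pos_iff[of \<eta>] assms by auto
  moreover have "A \<noteq> 0" "A \<noteq> y_bar \<eta>" using A(3) lo hi by auto
  ultimately show "\<exists>A. 0 < A \<and> A < y_bar \<eta> \<and> energy \<eta> A = peak_energy \<eta> a"
    by (auto simp: less_le)
next
  fix A B assume "0 < A \<and> A < y_bar \<eta> \<and> energy \<eta> A = peak_energy \<eta> a"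
    "0 < B \<and> B < y_bar \<eta> \<and> energy \<eta> B = peak_energy \<eta> a"
  then show "A = B"
    using energy_strict_mono[OF assms(1), of A B] energy_strict_mono[OF assms(1), of B A]
    by (cases A B rule: linorder_cases) auto
qed

lemma peak_of_amplitude:
  assumes "\<eta> \<ge> 0" "\<eta> < 1 / 2" "0 < A" "A < y_bar \<eta>"
  obtains a where "0 < a" "a < x_bar \<eta>" "peak_energy \<eta> a = energy \<eta> A"
proof -
  have lo: "peak_energy \<eta> 0 < energy \<eta> A"
    using energy_strict_mono[of \<eta> 0 A] assms by (simp add: energy_def drift_def peak_energy_def)
  have hi: "energy \<eta> A < peak_energy \<eta> (x_bar \<eta>)"
    using energy_strict_mono[of \<eta> A "y_bar \<eta>"] assms peak_energy_x_bar by simp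
  obtain a where a: "0 \<le> a" "a \<le> x_bar \<eta>" "peak_energy \<eta> a = energy \<eta> A"
    using IVT'[of "peak_energy \<eta>" 0 "energy \<eta> A" "x_bar \<eta>"] lo hi
      peak_energy_continuous[OF assms(1)] x_bar_pos[OF assms(1,2)] by auto
  moreover have "a \<noteq> 0" "a \<noteq> x_bar \<eta>" using a(3) lo hi by auto
  ultimately show ?thesis using that by (auto simp: less_le)
qed

definition amplitude :: "real \<Rightarrow> real \<Rightarrow> real" where
  "amplitude \<eta> a = (THE A. 0 < A \<and> A < y_bar \<eta> \<and> energy \<eta> A = peak_energy \<eta> a)"

lemma amplitude:
  assumes "\<eta> \<ge> 0" "\<eta> < 1 / 2" "0 < a" "a < x_bar \<eta>"
  shows "0 < amplitude \<eta> a" "amplitude \<eta> a < y_bar \<eta>" "energy \<eta> (amplitude \<eta> a) = peak_energy \<eta> a"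
  using theI'[OF amplitude_of_peak[OF assms]] by (simp_all add: amplitude_def)

lemma amplitude_strict_mono:
  assumes "\<eta> \<ge> 0" "\<eta> < 1 / 2" "0 < a" "a < a'" "a' < x_bar \<eta>"
  shows "amplitude \<eta> a < amplitude \<eta> a'"
proof (rule ccontr)
  assume "\<not> amplitude \<eta> a < amplitude \<eta> a'"
  then have "energy \<eta> (amplitude \<eta> a') \<le> energy \<eta> (amplitude \<eta> a)"
    using energy_strict_mono[of \<eta> "amplitude \<eta> a'" "amplitude \<eta> a"]
      amplitude[of \<eta> a] amplitude[of \<eta> a'] assms by (cases "amplitude \<eta> a' = amplitude \<eta> a") auto
  then show False
    using amplitude(3)[of \<eta> a] amplitude(3)[of \<eta> a'] peak_energy_strict_mono[of \<eta> a a'] assms by simp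
qed

lemma amplitude_surj:
  assumes "\<eta> \<ge> 0" "\<eta> < 1 / 2" "0 < A" "A < y_bar \<eta>"
  obtains a where "0 < a" "a < x_bar \<eta>" "amplitude \<eta> a = A"
proof -
  obtain a where a: "0 < a" "a < x_bar \<eta>" "peak_energy \<eta> a = energy \<eta> A"
    using peak_of_amplitude[OF assms] .
  then have "amplitude \<eta> a = A"
    using amplitude_of_peak[OF assms(1,2) a(1,2)] amplitude[OF assms(1,2) a(1,2)] assms by metis
  with a that show ?thesis by blast
qed

section \<open>The peak of \<open>x\<close> along an orbit\<close>

lemma orbit_periodic: "orbit \<eta> A (p + 2 * pi) = orbit \<eta> A p"
  by (simp add: orbit_def)

lemma orbit_antiperiodic: "orbit \<eta> A (p + pi) = - orbit \<eta> A p"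
  by (simp add: orbit_def drift_minus stiffness_def)

text \<open>If \<open>x\<close> exceeded \<open>a\<close>, it would take some value \<open>b\<close>
  between \<open>a\<close> and \<open>x_bar\<close>, because it changes sign after half a turn. The
  orbit's energy would then be at least \<open>peak_energy \<eta> b\<close>, hence larger than
  \<open>peak_energy \<eta> a\<close>. Keeping \<open>b\<close> below \<open>x_bar\<close> keeps it
  where \<open>peak_energy\<close> increases.\<close>

lemma orbit_le_peak:
  assumes "\<eta> \<ge> 0" "\<eta> < 1 / 2" "0 < a" "a < x_bar \<eta>"
  shows "fst (orbit \<eta> (amplitude \<eta> a) p) \<le> a"
proof (rule ccontr)
  define A where "A = amplitude \<eta> a"
  have A: "0 < A" "A < y_bar \<eta>" "energy \<eta> A = peak_energy \<eta> a"
    using amplitude[OF assms] by (simp_all add: A_def)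
  assume "\<not> fst (orbit \<eta> (amplitude \<eta> a) p) \<le> a"
  then have *: "a < min (fst (orbit \<eta> A p)) (x_bar \<eta>)" using assms by (simp add: A_def)
  obtain b where b: "a < b" "b < fst (orbit \<eta> A p)" "b < x_bar \<eta>"
    using dense[OF *] by auto
  have "continuous_on {p..p + pi} (\<lambda>p. fst (orbit \<eta> A p))"
    unfolding orbit_def drift_def by (intro continuous_intros) auto
  moreover have "fst (orbit \<eta> A (p + pi)) \<le> b"
    using b assms by (simp add: orbit_antiperiodic)
  ultimately obtain p' where "fst (orbit \<eta> A p') = b"
    using IVT2'[of "\<lambda>p. fst (orbit \<eta> A p)" "p + pi" b p] b by auto
  then have "orbit \<eta> A p' = (b, snd (orbit \<eta> A p'))" by (simp add: prod_eq_iff)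
  from orbit_energy[OF assms(1) _ A(2) this] A
  have "peak_energy \<eta> b \<le> energy \<eta> A"
    using peak_energy_le[of b \<eta> "snd (orbit \<eta> A p')"] b assms x_bar_le_1[of \<eta>] by simp
  moreover have "peak_energy \<eta> a < peak_energy \<eta> b"
    using b assms by (intro peak_energy_strict_mono) auto
  ultimately show False using A by simp
qed

lemma orbit_attains_peak:
  assumes "\<eta> \<ge> 0" "\<eta> < 1 / 2" "0 < a" "a < x_bar \<eta>"
  obtains p where "fst (orbit \<eta> (amplitude \<eta> a) p) = a"
proof -
  define A where "A = amplitude \<eta> a"
  have A: "0 < A" "A < y_bar \<eta>" "energy \<eta> A = peak_energy \<eta> a"
    using amplitude[OF assms] by (simp_all add: A_def)
  \<comment> \<open>The minimiser of the completed square, so that \<open>(a, b)\<close> has exactly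
    the energy of the orbit.\<close>
  define b where "b = 2 * \<eta> * a / (1 - a)"
  have a1: "a < 1" using assms x_bar_le_1[of \<eta>] by simp
  have b0: "b \<ge> 0" using assms a1 by (simp add: b_def)
  \<comment> \<open>By \<open>y_bar_x_bar\<close>, comparing \<open>a\<close> with
    \<open>x_bar\<close> gives \<open>b < y_bar\<close>. On that range \<open>energy\<close> is
    monotone, so the energy comparison yields \<open>b <= A\<close>.\<close>
  have "2 * \<eta> * a \<le> 2 * \<eta> * x_bar \<eta>" using assms by (intro mult_left_mono) auto
  also have "\<dots> = y_bar \<eta> * (1 - x_bar \<eta>)" by (simp add: y_bar_x_bar)
  also have "\<dots> < y_bar \<eta> * (1 - a)" using assms A by (intro mult_strict_left_mono) auto
  finally have b_less: "b < y_bar \<eta>" using a1 by (simp add: b_def divide_simps)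
  have E: "(a - drift \<eta> b)\<^sup>2 + energy \<eta> b = energy \<eta> A"
    using hamiltonian_complete_square[OF b0 a1] A by (simp add: b_def)
  then have "energy \<eta> b \<le> energy \<eta> A" by (smt (verit) zero_le_power2)
  then have "b \<le> A" using energy_strict_mono[OF assms(1), of A b] A b_less by fastforce
  with b0 have "\<bar>b\<bar> \<le> A" by simp
  from orbit_covers_level_set[OF assms(1) A(1,2) this E] obtain p where "orbit \<eta> A p = (a, b)" .
  then show ?thesis using that[of p] by (simp add: A_def)
qed

section \<open>The family of periodic solutions\<close>

text \<open>Time is shifted so that the angle of the peak is reached at 0. The statement about the
  range serves to match a turning point of an arbitrary periodic solution with this one.\<close>

lemma reference_solution:
  assumes "\<eta> \<ge> 0" "\<eta> < 1 / 2" "0 < a" "a < x_bar \<eta>"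
  shows "\<exists>z. mfg_solution \<eta> z \<and> has_peak_amplitude z a \<and> fst (z 0) = a \<and>
    has_period z (orbit_period \<eta> (amplitude \<eta> a)) \<and> range z = range (orbit \<eta> (amplitude \<eta> a))"
proof -
  define A where "A = amplitude \<eta> a"
  have A: "0 < A" "A < y_bar \<eta>" using amplitude[OF assms] by (simp_all add: A_def)
  define w where "w p = sqrt (stiffness \<eta> A (sin p))" for p
  have wpos: "w p > 0" for p using stiffness_pos[of \<eta> A] assms A by (simp add: w_def)
  have w_le: "w p \<le> sqrt (1 - 4 * \<eta>\<^sup>2)" for p
    using stiffness_strict_decreasing[of \<eta> 0 A "sin p"] assms A
    by (simp add: w_def stiffness_def[of _ 0])
  have w_cont: "continuous_on UNIV w" unfolding w_def by (intro continuous_intros)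
  have w_per: "w (p + 2 * pi) = w p" for p by (simp add: w_def)
  have "orbit_period \<eta> A = integral {0..2 * pi} (\<lambda>p. 1 / w p)"
    by (simp add: orbit_period_def w_def)
  then obtain \<phi> where \<phi>: "\<And>t. (\<phi> has_real_derivative w (\<phi> t)) (at t)" "\<phi> 0 = 0" "surj \<phi>"
    "\<And>t. \<phi> (t + orbit_period \<eta> A) = \<phi> t + 2 * pi"
    using angle_equation[OF w_cont wpos w_le w_per] by metis
  have mono: "\<phi> s < \<phi> t" if "s < t" for s t
    using that \<phi>(1) wpos by (intro DERIV_pos_imp_increasing[of s t \<phi>]) blast+
  have T: "orbit_period \<eta> A > 0"
  proof (rule ccontr)
    assume "\<not> orbit_period \<eta> A > 0"
    then have "\<phi> (0 + orbit_period \<eta> A) \<le> \<phi> 0"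
      using mono[of "orbit_period \<eta> A" 0] by (cases "orbit_period \<eta> A = 0") auto
    then show False using \<phi>(4)[of 0] pi_gt_zero by simp
  qed
  obtain p where p: "fst (orbit \<eta> A p) = a" using orbit_attains_peak[OF assms] by (auto simp: A_def)
  obtain t0 where t0: "\<phi> t0 = p" using \<phi>(3) by (metis surj_def)
  define z where "z t = orbit \<eta> A (\<phi> (t + t0))" for t
  have "mfg_solution \<eta> z"
    unfolding z_def using assms A \<phi>(1)
    by (intro mfg_solution_shift[of \<eta> "\<lambda>t. orbit \<eta> A (\<phi> t)"] orbit_solution) (auto simp: w_def)
  moreover have z0: "fst (z 0) = a" using p t0 by (simp add: z_def)
  moreover have "has_peak_amplitude z a"
    unfolding has_peak_amplitude_def using z0 orbit_le_peak[OF assms]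
    by (metis A_def z_def)
  moreover have "range z = range (orbit \<eta> A)"
  proof -
    have "surj (\<lambda>t. \<phi> (t + t0))"
      using \<phi>(3) by (metis (mono_tags, lifting) diff_add_cancel surj_def)
    then have "orbit \<eta> A ` range (\<lambda>t. \<phi> (t + t0)) = range (orbit \<eta> A)" by simp
    then show ?thesis by (simp add: z_def[abs_def] image_image)
  qed
  moreover have "has_period z (orbit_period \<eta> A)"
    unfolding has_period_def
  proof (intro conjI allI impI T)
    fix t
    show "z (t + orbit_period \<eta> A) = z t"
      using \<phi>(4)[of "t + t0"] by (simp add: z_def orbit_periodic add_ac)
  next
    fix S assume S: "0 < S \<and> S < orbit_period \<eta> A"
    have q: "0 < \<phi> S" "\<phi> S < 2 * pi" using mono[of 0 S] mono[of S "orbit_period \<eta> A"] S \<phi>(2) \<phi>(4)[of 0] by auto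
    \<comment> \<open>At time \<open>- t0\<close> the angle is 0. A return to the same point needs
      sine 0 and cosine 1, impossible for an angle strictly between 0 and
      \<open>2 * pi\<close>.\<close>
    have "z (- t0 + S) \<noteq> z (- t0)"
    proof
      assume "z (- t0 + S) = z (- t0)"
      then have eq: "orbit \<eta> A (\<phi> S) = orbit \<eta> A 0" using \<phi>(2) by (simp add: z_def)
      have "sin (\<phi> S) = 0" using eq A by (auto simp: orbit_def)
      moreover have "A * (cos (\<phi> S) * w (\<phi> S)) = A * w (\<phi> S)"
        using eq \<open>sin (\<phi> S) = 0\<close> by (simp add: orbit_def w_def)
      then have "cos (\<phi> S) = 1" using A wpos[of "\<phi> S"] by simp
      then have "(sin (\<phi> S / 2))\<^sup>2 = 0" using cos_double_sin[of "\<phi> S / 2"] by simp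
      moreover have "sin (\<phi> S / 2) > 0" using q by (intro sin_gt_zero) auto
      ultimately show False by simp
    qed
    then show "\<exists>t. z (t + S) \<noteq> z t" by blast
  qed
  ultimately show ?thesis by (auto simp: A_def)
qed

lemma has_period_nonconstant:
  assumes "has_period z T" obtains s t where "z s \<noteq> z t"
  using assms unfolding has_period_def by (metis field_sum_of_halves half_gt_zero less_add_same_cancel1)

lemma has_peak_amplitude_unique: "has_peak_amplitude z a \<Longrightarrow> has_peak_amplitude z b \<Longrightarrow> a = b"
  unfolding has_peak_amplitude_def by (metis order_antisym)

lemma has_peak_amplitude_shift:
  assumes "has_peak_amplitude z a" shows "has_peak_amplitude (\<lambda>t. z (t + s)) a"
  using assms unfolding has_peak_amplitude_def by (metis diff_add_cancel)

lemma mfg_solution_bounded: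
  assumes "mfg_solution \<eta> z" "T > 0" "\<And>t. z (t + T) = z t" shows "bounded (range z)"
  using periodic_compact_range[OF mfg_solution_continuous[OF assms(1)] assms(2,3)]
  by (rule compact_imp_bounded)

text \<open>The peak survives time shifts and so determines \<open>a\<close>; minimality of the
  period then determines \<open>s\<close>. Conversely, a periodic solution meets a reference orbit
  at its turning point, and uniqueness makes it a shift of that reference solution.\<close>

lemma indexed_by_peak_and_phaseI:
  assumes \<eta>: "\<eta> \<ge> 0" "\<eta> < 1 / 2"
    and Z: "\<And>a. 0 < a \<Longrightarrow> a < x_bar \<eta> \<Longrightarrow> mfg_solution \<eta> (Z a) \<and> has_peak_amplitude (Z a) a \<and>
      fst (Z a 0) = a \<and> has_period (Z a) (T a) \<and> range (Z a) = range (orbit \<eta> (amplitude \<eta> a))"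
  shows "indexed_by_peak_and_phase \<eta> Z T"
  unfolding indexed_by_peak_and_phase_def
proof
  show "\<forall>a\<in>{0<..<x_bar \<eta>}. has_peak_amplitude (Z a) a \<and> fst (Z a 0) = a \<and> has_period (Z a) (T a)"
    using Z by simp
  have per: "T a > 0" "Z a (t + T a) = Z a t" if "0 < a" "a < x_bar \<eta>" for a t
    using Z[OF that] by (simp_all add: has_period_def)
  have bounded: "bounded (range (Z a))" if "0 < a" "a < x_bar \<eta>" for a
    using mfg_solution_bounded[of \<eta> "Z a" "T a"] Z[OF that] per[OF that] by simp
  let ?F = "\<lambda>(a, s). \<lambda>t. Z a (t + s)"
  let ?D = "SIGMA a:{0<..<x_bar \<eta>}. {0..<T a}"
  \<comment> \<open>Otherwise \<open>s' - s\<close> would be a positive period smaller than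
    \<open>T a\<close>.\<close>
  have same_phase: "\<not> s < s'" if h: "0 < a" "a < x_bar \<eta>" "0 \<le> s" "s' < T a"
      "(\<lambda>t. Z a (t + s)) = (\<lambda>t. Z a (t + s'))" for a s s'
  proof
    assume "s < s'"
    then obtain t where t: "Z a (t + (s' - s)) \<noteq> Z a t"
      using Z[OF h(1,2)] h(3,4) unfolding has_period_def by (smt (verit))
    have "Z a (t - s + s) = Z a (t - s + s')" using h(5) by meson
    with t show False by (simp add: algebra_simps)
  qed
  have "inj_on ?F ?D"
  proof (rule inj_onI, clarify)
    fix a s a' s'
    assume D: "a \<in> {0<..<x_bar \<eta>}" "a' \<in> {0<..<x_bar \<eta>}" "s \<in> {0..<T a}" "s' \<in> {0..<T a'}"
      and eq: "(\<lambda>t. Z a (t + s)) = (\<lambda>t. Z a' (t + s'))"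
    have "has_peak_amplitude (\<lambda>t. Z a (t + s)) a" "has_peak_amplitude (\<lambda>t. Z a' (t + s')) a'"
      using D Z by (auto intro!: has_peak_amplitude_shift)
    then have "a = a'" using eq has_peak_amplitude_unique by metis
    moreover have "s = s'"
      using same_phase[of a s s'] same_phase[of a s' s] D eq \<open>a = a'\<close>
      by (cases s s' rule: linorder_cases) auto
    ultimately show "a = a' \<and> s = s'" by simp
  qed
  moreover have "?F ` ?D = {z. nonconstant_periodic_solution \<eta> z}"
  proof (intro subset_antisym subsetI)
    fix z assume "z \<in> ?F ` ?D"
    then obtain a s where a: "0 < a" "a < x_bar \<eta>" and z: "z = (\<lambda>t. Z a (t + s))" by auto
    obtain u v where "Z a u \<noteq> Z a v" using has_period_nonconstant Z[OF a] by blast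
    then have "z (u - s) \<noteq> z (v - s)" by (simp add: z)
    moreover have "z (t + T a) = z t" for t
      using per(2)[OF a, of "t + s"] by (simp add: z add_ac)
    ultimately show "z \<in> {z. nonconstant_periodic_solution \<eta> z}"
      using mfg_solution_shift[of \<eta> "Z a" s] Z[OF a] per(1)[OF a]
      unfolding nonconstant_periodic_solution_def z by blast
  next
    fix z assume "z \<in> {z. nonconstant_periodic_solution \<eta> z}"
    then have z: "nonconstant_periodic_solution \<eta> z" by simp
    then obtain t0 where t0: "0 < snd (z t0)" "snd (z t0) < y_bar \<eta>" "fst (z t0) = drift \<eta> (snd (z t0))"
      using periodic_solution_turning_point[OF \<eta>(1)] by blast
    define A where "A = snd (z t0)"
    obtain a where a: "0 < a" "a < x_bar \<eta>" "amplitude \<eta> a = A"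
      using amplitude_surj[OF \<eta>, of A] t0 by (auto simp: A_def)
    \<comment> \<open>At angle \<open>pi / 2\<close> the cosine term vanishes, leaving
      \<open>(drift \<eta> A, A)\<close>.\<close>
    have "z t0 = orbit \<eta> A (pi / 2)" using t0 by (simp add: orbit_def A_def prod_eq_iff)
    then have "z t0 \<in> range (Z a)" using Z[OF a(1,2)] a(3) by simp
    then obtain s0 where s0: "z t0 = Z a s0" by auto
    have sol: "mfg_solution \<eta> z" and bd: "bounded (range z)"
      using z mfg_solution_bounded by (auto simp: nonconstant_periodic_solution_def)
    have sol': "mfg_solution \<eta> (\<lambda>t. Z a (t + (s0 - t0)))"
      using mfg_solution_shift Z[OF a(1,2)] by blast
    have bd': "bounded (range (\<lambda>t. Z a (t + (s0 - t0))))"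
      by (rule bounded_subset[OF bounded[OF a(1,2)]]) auto
    have "z t = Z a (t + (s0 - t0))" for t
      using bounded_mfg_solution_unique[OF \<eta>(1) sol sol' bd bd', of t0] s0 by simp
    moreover obtain s where "s \<in> {0..<T a}" "\<And>t. Z a (t + (s0 - t0)) = Z a (t + s)"
      using periodic_representative[of "T a" "Z a"] per[OF a(1,2)] by metis
    ultimately have "z = ?F (a, s)" "(a, s) \<in> ?D" using a by auto
    then show "z \<in> ?F ` ?D" by blast
  qed
  ultimately show "bij_betw ?F ?D {z. nonconstant_periodic_solution \<eta> z}"
    by (simp add: bij_betw_def)
qed

theorem mainTheorem3:
  fixes \<eta> :: real
  assumes "\<eta> \<ge> 0"
  shows "(\<eta> < 1/2 \<longrightarrow>
           {p. equilibrium_point \<eta> p} = {(0, 0), P_bar \<eta>, - P_bar \<eta>} \<and>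
           (\<exists>Z T. indexed_by_peak_and_phase \<eta> Z T \<and>
              continuous_on {0<..<x_bar \<eta>} T \<and>
              strict_mono_on {0<..<x_bar \<eta>} T \<and>
              T ` {0<..<x_bar \<eta>} = {2 * pi / sqrt (1 - 4 * \<eta>\<^sup>2)<..})) \<and>
         (\<eta> \<ge> 1/2 \<longrightarrow>
           {p. equilibrium_point \<eta> p} = {(0, 0)} \<and>
           \<not> (\<exists>z. nonconstant_periodic_solution \<eta> z))"
proof (intro conjI impI)
  assume \<eta>: "\<eta> < 1/2"
  show "{p. equilibrium_point \<eta> p} = {(0, 0), P_bar \<eta>, - P_bar \<eta>}"
    by (rule equilibria_subcritical[OF assms \<eta>])
  define T where "T a = orbit_period \<eta> (amplitude \<eta> a)" for a
  obtain Z where "\<And>a. 0 < a \<Longrightarrow> a < x_bar \<eta> \<Longrightarrow> mfg_solution \<eta> (Z a) \<and> has_peak_amplitude (Z a) a \<and>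
      fst (Z a 0) = a \<and> has_period (Z a) (T a) \<and> range (Z a) = range (orbit \<eta> (amplitude \<eta> a))"
    using reference_solution[OF assms \<eta>] unfolding T_def by metis
  then have index: "indexed_by_peak_and_phase \<eta> Z T"
    by (rule indexed_by_peak_and_phaseI[OF assms \<eta>])
  have mono: "strict_mono_on {0<..<x_bar \<eta>} T"
  proof (rule strict_mono_onI)
    fix a b assume "a \<in> {0<..<x_bar \<eta>}" "b \<in> {0<..<x_bar \<eta>}" "a < b"
    then show "T a < T b"
      unfolding T_def using amplitude[OF assms \<eta>, of a] amplitude[OF assms \<eta>, of b]
      by (intro orbit_period_strict_mono[OF assms] amplitude_strict_mono[OF assms \<eta>]) auto
  qed
  have "amplitude \<eta> ` {0<..<x_bar \<eta>} = {0<..<y_bar \<eta>}"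
  proof
    show "amplitude \<eta> ` {0<..<x_bar \<eta>} \<subseteq> {0<..<y_bar \<eta>}"
      using amplitude(1,2)[OF assms \<eta>] by auto
    show "{0<..<y_bar \<eta>} \<subseteq> amplitude \<eta> ` {0<..<x_bar \<eta>}"
    proof
      fix A assume "A \<in> {0<..<y_bar \<eta>}"
      then obtain a where "0 < a" "a < x_bar \<eta>" "amplitude \<eta> a = A"
        using amplitude_surj[OF assms \<eta>, of A] by auto
      then show "A \<in> amplitude \<eta> ` {0<..<x_bar \<eta>}" by auto
    qed
  qed
  then have image: "T ` {0<..<x_bar \<eta>} = {2 * pi / sqrt (1 - 4 * \<eta>\<^sup>2)<..}"
    using orbit_period_image[OF assms \<eta>] image_image[of "orbit_period \<eta>" "amplitude \<eta>" "{0<..<x_bar \<eta>}"]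
    by (simp only: T_def[abs_def])
  \<comment> \<open>A monotone function with an open image has no jumps, so continuity follows from
    the image computed above.\<close>
  have "continuous_on {0<..<x_bar \<eta>} T"
  proof (rule continuous_onI_mono)
    show "open (T ` {0<..<x_bar \<eta>})" unfolding image by simp
    show "T a \<le> T b" if "a \<in> {0<..<x_bar \<eta>}" "b \<in> {0<..<x_bar \<eta>}" "a \<le> b" for a b
      using strict_mono_on_leD[OF mono that] .
  qed
  with index mono image show "\<exists>Z T. indexed_by_peak_and_phase \<eta> Z T \<and>
              continuous_on {0<..<x_bar \<eta>} T \<and>
              strict_mono_on {0<..<x_bar \<eta>} T \<and>
              T ` {0<..<x_bar \<eta>} = {2 * pi / sqrt (1 - 4 * \<eta>\<^sup>2)<..}" by blast
next
  assume \<eta>: "\<eta> \<ge> 1/2"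
  show "{p. equilibrium_point \<eta> p} = {(0, 0)}" by (rule equilibria_supercritical[OF \<eta>])
  show "\<not> (\<exists>z. nonconstant_periodic_solution \<eta> z)"
  proof
    assume "\<exists>z. nonconstant_periodic_solution \<eta> z"
    then obtain y where "0 < y" "y < y_bar \<eta>"
      using periodic_solution_turning_point[OF assms] by blast
    then show False using y_bar_pos_iff[OF assms] \<eta> by simp
  qed
qed

end
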